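(* Let $\mathcal{Z}$ be a Borel P-ideal on $\mathbb{N}$ which contains all singletons $\{n\}$ and is different from $\mathcal{P}(\mathbb{N})$. Suppose that $\mathcal{Z}\neq\mathrm{Fin}$, that $\mathcal{Z}$ is not a trivial variation of $\mathrm{Fin}$, and that $\mathcal{Z}$ is not isomorphic to $\mathcal{I}_3$ via a bijection between the underlying sets. Then the equivalence relation $\mathsf{E}_{\mathcal{Z}}$ is not Borel reducible to any equivalence relation in Class 4.
   Context: An ideal on $\mathbb{N}$ is a nonempty family of subsets of $\mathbb{N}$ closed under finite unions and subsets. It is a P-ideal if for every sequence $x_n\in\mathcal{Z}$ there is $x\in\mathcal{Z}$ with $x_n\setminus x$ finite for all $n$. $\mathsf{E}_{\mathcal{Z}}$ is the equivalence relation on $\mathcal{P}(\mathbb{N})$ (identified with $2^{\mathbb{N}}$) given by $x\,\mathsf{E}_{\mathcal{Z}}\,y$ iff $x\triangle y\in\mathcal{Z}$. $\mathrm{Fin}$ is the ideal of finite subsets of $\mathbb{N}$; a trivial variation of $\mathrm{Fin}$ is an ideal $\{x\subseteq\mathbb{N}: x\cap W\text{ finite}\}$ with $W\subseteq\mathbb{N}$ infinite and coinfinite. $\mathcal{I}_3$ is the ideal on $\mathbb{N}^2$ of all $x\subseteq\mathbb{N}^2$ such that each section $\{k:\langle n,k\rangle\in x\}$ is finite. Borel reducibility $\mathsf{E}\le_B\mathsf{F}$ means there is a Borel map $\vartheta$ with $x\,\mathsf{E}\,y\iff\vartheta(x)\,\mathsf{F}\,\vartheta(y)$. Class 4 is the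 least class of equivalence relations on Polish spaces that contains the equality relation on every Polish space and is closed under: (e1) countable union (when the union is an equivalence relation) and countable intersection of equivalence relations on the same space; (e2) countable disjoint union: for $\mathsf{F}_k$ on $\mathbb{Y}_k$, the relation on $\bigcup_k(\{k\}\times\mathbb{Y}_k)$ with $\langle k,x\rangle\,\mathsf{F}\,\langle l,y\rangle$ iff $k=l$ and $x\,\mathsf{F}_k\,y$; (e3) products: $\prod_k\mathsf{F}_k$ on $\prod_k\mathbb{Y}_k$, $x\,\mathsf{F}\,y$ iff $x_k\,\mathsf{F}_k\,y_k$ for all $k$ (including finite products); (e4) Fubini product modulo $\mathrm{Fin}$: on $\prod_k\mathbb{Y}_k$, $x\,\mathsf{F}\,y$ iff $\{k:\neg(x_k\,\mathsf{F}_k\,y_k)\}$ is finite; (e5) countable power: for $\mathsf{F}$ on $\mathbb{Y}$, $\mathsf{F}^\infty$ on $\mathbb{Y}^{\mathbb{N}}$ with $x\,\mathsf{F}^\infty\,y$ iff $\forall k\,\exists l\,(x_k\,\mathsf{F}\,y_l)$ and $\forall l\,\exists k\,(x_k\,\mathsf{F}\,y_l)$. *)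

theory Defs
  imports "HOL-Analysis.Analysis"
begin

section \<open>Ideals\<close>

definition set_ideal :: "'a set set \<Rightarrow> bool" where
  "set_ideal Z \<longleftrightarrow>
     Z \<noteq> {} \<and> (\<forall>x\<in>Z. \<forall>y\<in>Z. x \<union> y \<in> Z) \<and> (\<forall>x\<in>Z. \<forall>y. y \<subseteq> x \<longrightarrow> y \<in> Z)"

definition P_ideal :: "'a set set \<Rightarrow> bool" where
  "P_ideal Z \<longleftrightarrow>
     set_ideal Z \<and> (\<forall>x :: nat \<Rightarrow> 'a set. range x \<subseteq> Z \<longrightarrow> (\<exists>y\<in>Z. \<forall>n. finite (x n - y)))"

definition Fin :: "nat set set" where
  "Fin = {x. finite x}"

definition trivial_variation_of_Fin :: "nat set set \<Rightarrow> bool" where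
  "trivial_variation_of_Fin Z \<longleftrightarrow>
     (\<exists>W. infinite W \<and> infinite (- W) \<and> Z = {x. finite (x \<inter> W)})"

definition I3 :: "(nat \<times> nat) set set" where
  "I3 = {x. \<forall>n. finite {k. (n, k) \<in> x}}"

definition isomorphic_ideals :: "'a set set \<Rightarrow> 'b set set \<Rightarrow> bool" where
  "isomorphic_ideals Z W \<longleftrightarrow> (\<exists>f. bij f \<and> (\<forall>x. x \<in> Z \<longleftrightarrow> f ` x \<in> W))"

definition ideal_rel :: "'a set set \<Rightarrow> ('a set \<times> 'a set) set" where
  "ideal_rel Z = {(x, y). sym_diff x y \<in> Z}"


section \<open>Polish spaces and Borel reducibility\<close>

definition polish_space :: "'a topology \<Rightarrow> bool" where
  "polish_space X \<longleftrightarrow> completely_metrizable_space X \<and> separable_space X"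

definition borel_of :: "'a topology \<Rightarrow> 'a measure" where
  "borel_of X = sigma (topspace X) {U. openin X U}"

text \<open>The power set of the naturals, with the topology obtained by identifying a set with its
  characteristic function.\<close>

definition cantor_space :: "nat set topology" where
  "cantor_space =
     pullback_topology UNIV (\<lambda>x n. n \<in> x) (product_topology (\<lambda>_. discrete_topology UNIV) UNIV)"

definition borel_reducible ::
    "'a topology \<Rightarrow> ('a \<times> 'a) set \<Rightarrow> 'b topology \<Rightarrow> ('b \<times> 'b) set \<Rightarrow> bool" where
  "borel_reducible X E Y F \<longleftrightarrow>
     (\<exists>f \<in> measurable (borel_of X) (borel_of Y).
        \<forall>x\<in>topspace X. \<forall>y\<in>topspace X. (x, y) \<in> E \<longleftrightarrow> (f x, f y) \<in> F)"


section \<open>Operations on equivalence relations\<close>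

definition disjoint_sum_rel ::
    "nat set \<Rightarrow> (nat \<Rightarrow> ('a \<times> 'a) set) \<Rightarrow> ((nat \<times> 'a) \<times> (nat \<times> 'a)) set" where
  "disjoint_sum_rel I F = {((k, x), (l, y)). k \<in> I \<and> k = l \<and> (x, y) \<in> F k}"

definition product_rel ::
    "nat set \<Rightarrow> (nat \<Rightarrow> 'a topology) \<Rightarrow> (nat \<Rightarrow> ('a \<times> 'a) set)
       \<Rightarrow> ((nat \<Rightarrow> 'a) \<times> (nat \<Rightarrow> 'a)) set" where
  "product_rel I Y F =
     {(x, y). x \<in> topspace (product_topology Y I) \<and> y \<in> topspace (product_topology Y I) \<and>
              (\<forall>k\<in>I. (x k, y k) \<in> F k)}"

definition fubini_rel ::
    "(nat \<Rightarrow> 'a topology) \<Rightarrow> (nat \<Rightarrow> ('a \<times> 'a) set) \<Rightarrow> ((nat \<Rightarrow> 'a) \<times> (nat \<Rightarrow> 'a)) set" where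
  "fubini_rel Y F =
     {(x, y). x \<in> topspace (product_topology Y UNIV) \<and> y \<in> topspace (product_topology Y UNIV) \<and>
              finite {k. (x k, y k) \<notin> F k}}"

definition countable_power_rel ::
    "'a topology \<Rightarrow> ('a \<times> 'a) set \<Rightarrow> ((nat \<Rightarrow> 'a) \<times> (nat \<Rightarrow> 'a)) set" where
  "countable_power_rel Y F =
     {(x, y). x \<in> topspace (product_topology (\<lambda>_. Y) UNIV) \<and>
              y \<in> topspace (product_topology (\<lambda>_. Y) UNIV) \<and>
              (\<forall>k. \<exists>l. (x k, y l) \<in> F) \<and> (\<forall>l. \<exists>k. (x k, y l) \<in> F)}"

text \<open>A homeomorphism of the underlying spaces that carries one relation to the other.\<close>

definition rel_homeomorphic ::
    "'a topology \<Rightarrow> ('a \<times> 'a) set \<Rightarrow> 'b topology \<Rightarrow> ('b \<times> 'b) set \<Rightarrow> bool" where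
  "rel_homeomorphic X E Y F \<longleftrightarrow>
     (\<exists>h. homeomorphic_map X Y h \<and>
          E = {(x, y). x \<in> topspace X \<and> y \<in> topspace X \<and> (h x, h y) \<in> F})"


section \<open>Class 4\<close>

text \<open>Products and disjoint sums leave the type of the factors, so the least class cannot be
  defined inductively on all types at once. Every Polish space has at most continuum many points
  and hence a homeomorphic copy carried by a subset of the type \<^typ>\<open>nat set\<close> (lemma
  \<open>polish_space_copy\<close> below). We therefore first generate the class on the spaces carried by this
  type, replacing each product or sum by its homeomorphic copies there, and then close under
  homeomorphism into arbitrary types. The type \<^typ>\<open>nat set\<close> only serves as a pool of
  points: the topologies on it are arbitrary. Index sets are arbitrary sets of naturals for
  products and disjoint sums, which includes the finite ones. The lemmas \<open>class4_equality\<close> to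
  \<open>class4_power\<close> at the end show that the resulting class has the closure properties on all
  types.\<close>

inductive class4_code :: "nat set topology \<Rightarrow> (nat set \<times> nat set) set \<Rightarrow> bool" where
  equality:
    "polish_space X \<Longrightarrow> class4_code X (Id_on (topspace X))"
| union:
    "\<lbrakk>\<And>k :: nat. class4_code X (E k); equiv (topspace X) (\<Union>k. E k)\<rbrakk> \<Longrightarrow> class4_code X (\<Union>k. E k)"
| intersection:
    "(\<And>k :: nat. class4_code X (E k)) \<Longrightarrow> class4_code X (\<Inter>k. E k)"
| disjoint_sum:
    "\<lbrakk>\<And>k. k \<in> I \<Longrightarrow> class4_code (Y k) (F k);
      rel_homeomorphic X E (sum_topology Y I) (disjoint_sum_rel I F)\<rbrakk> \<Longrightarrow> class4_code X E"
| product: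
    "\<lbrakk>\<And>k. k \<in> I \<Longrightarrow> class4_code (Y k) (F k);
      rel_homeomorphic X E (product_topology Y I) (product_rel I Y F)\<rbrakk> \<Longrightarrow> class4_code X E"
| fubini:
    "\<lbrakk>\<And>k. class4_code (Y k) (F k);
      rel_homeomorphic X E (product_topology Y UNIV) (fubini_rel Y F)\<rbrakk> \<Longrightarrow> class4_code X E"
| power:
    "\<lbrakk>class4_code Y F;
      rel_homeomorphic X E (product_topology (\<lambda>_. Y) UNIV) (countable_power_rel Y F)\<rbrakk>
     \<Longrightarrow> class4_code X E"

definition class4 :: "'a topology \<Rightarrow> ('a \<times> 'a) set \<Rightarrow> bool" where
  "class4 X E \<longleftrightarrow> (\<exists>X' E'. class4_code X' E' \<and> rel_homeomorphic X E X' E')"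



section \<open>Class 4 does not depend on the encoding\<close>

lemma polish_space_inj:
  fixes X :: "'a topology"
  assumes "polish_space X"
  obtains g :: "'a \<Rightarrow> nat set" where "inj_on g (topspace X)"
proof -
  obtain M d where M: "Metric_space M d" and X: "X = Metric_space.mtopology M d"
    using assms unfolding polish_space_def completely_metrizable_space_def by blast
  interpret Metric_space M d by fact
  obtain C where C: "countable C" "C \<subseteq> M" "mtopology closure_of C = M"
    using assms X unfolding polish_space_def separable_space_def by auto
  define g where
    "g x = {prod_encode (n, m) |n m. from_nat_into C n \<in> C \<and> d x (from_nat_into C n) < 1 / real (Suc m)}" for x
  have sep: False if x: "x \<in> M" and y: "y \<in> M" and ne: "x \<noteq> y" and eq: "g x = g y" for x y
  proof -
    have "d x y > 0" using x y ne by simp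
    then obtain m where m: "1 / real (Suc m) < d x y / 2"
      using nat_approx_posE[of "d x y / 2"] by auto
    have "x \<in> mtopology closure_of C" using C x by simp
    then obtain c where c: "c \<in> C" "d x c < 1 / real (Suc m)"
      unfolding metric_closure_of in_mball mem_Collect_eq
      by (metis of_nat_0_less_iff zero_less_Suc zero_less_divide_1_iff)
    have cM: "c \<in> M" using c C by blast
    obtain n where n: "from_nat_into C n = c"
      using c C from_nat_into_surj by metis
    have "prod_encode (n, m) \<in> g x"
      unfolding g_def using n c by blast
    then have "prod_encode (n, m) \<in> g y" using eq by simp
    then have "d y c < 1 / real (Suc m)" unfolding g_def using n by auto
    moreover have "d x y \<le> d x c + d c y" using triangle x y cM by blast
    moreover have "d c y = d y c" by (rule commute)
    ultimately show False using c m by linarith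
  qed
  have "inj_on g (topspace X)"
    unfolding X topspace_mtopology by (rule inj_onI) (use sep in blast)
  then show ?thesis by (rule that)
qed

lemma homeomorphic_copy:
  fixes X :: "'a topology" and g :: "'a \<Rightarrow> 'b"
  assumes g: "inj_on g (topspace X)"
  obtains X' g' where "homeomorphic_maps X X' g g'"
proof -
  define g' where "g' = inv_into (topspace X) g"
  define X' where "X' = pullback_topology (g ` topspace X) g' X"
  have g'g: "g' (g x) = x" if "x \<in> topspace X" for x
    using g that by (simp add: g'_def)
  have top: "topspace X' = g ` topspace X"
    unfolding X'_def topspace_pullback_topology using g'g by auto
  have "continuous_map X' X g'"
    unfolding X'_def using continuous_map_pullback[of X X id] by simp
  moreover have "continuous_map X X' g"
    unfolding X'_def
  proof (rule continuous_map_pullback')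
    show "continuous_map X X (g' \<circ> g)"
      by (rule continuous_map_eq[OF continuous_map_id]) (simp add: g'g)
    show "topspace X \<subseteq> g -` (g ` topspace X)" by auto
  qed
  ultimately have "homeomorphic_maps X X' g g'"
    unfolding homeomorphic_maps_def using g'g by (auto simp: top)
  then show ?thesis by (rule that)
qed

lemma polish_space_copy:
  fixes X :: "'a topology"
  assumes "polish_space X"
  obtains X' :: "nat set topology" where "X homeomorphic_space X'"
  using polish_space_inj[OF assms] homeomorphic_copy unfolding homeomorphic_space_def by metis

lemma rel_homeomorphicI:
  assumes "homeomorphic_maps X Y h h'" and "E \<subseteq> topspace X \<times> topspace X"
    and "\<And>x y. \<lbrakk>x \<in> topspace X; y \<in> topspace X\<rbrakk> \<Longrightarrow> (x, y) \<in> E \<longleftrightarrow> (h x, h y) \<in> F"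
  shows "rel_homeomorphic X E Y F"
  unfolding rel_homeomorphic_def using assms homeomorphic_maps_map by blast

lemma rel_homeomorphic_trans:
  assumes "rel_homeomorphic X E Y F" "rel_homeomorphic Y F Z G"
  shows "rel_homeomorphic X E Z G"
proof -
  obtain h where h: "homeomorphic_map X Y h"
    "E = {(x, y). x \<in> topspace X \<and> y \<in> topspace X \<and> (h x, h y) \<in> F}"
    using assms unfolding rel_homeomorphic_def by auto
  obtain k where k: "homeomorphic_map Y Z k"
    "F = {(x, y). x \<in> topspace Y \<and> y \<in> topspace Y \<and> (k x, k y) \<in> G}"
    using assms unfolding rel_homeomorphic_def by auto
  have "h x \<in> topspace Y" if "x \<in> topspace X" for x
    using homeomorphic_imp_surjective_map[OF h(1)] that by auto
  then show ?thesis
    unfolding rel_homeomorphic_def using homeomorphic_map_compose[OF h(1) k(1)]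
    by (intro exI[of _ "k \<circ> h"]) (auto simp: h(2) k(2))
qed

lemma rel_homeomorphic_sym:
  assumes "rel_homeomorphic X E Y F" "F \<subseteq> topspace Y \<times> topspace Y"
  shows "rel_homeomorphic Y F X E"
proof -
  obtain h where h: "homeomorphic_map X Y h"
    "E = {(x, y). x \<in> topspace X \<and> y \<in> topspace X \<and> (h x, h y) \<in> F}"
    using assms unfolding rel_homeomorphic_def by auto
  obtain h' where h': "homeomorphic_maps X Y h h'"
    using h homeomorphic_map_maps by blast
  have "h' y \<in> topspace X \<and> h (h' y) = y" if "y \<in> topspace Y" for y
    using h' that unfolding homeomorphic_maps_def continuous_map_def by auto
  moreover have "homeomorphic_maps Y X h' h"
    using h' homeomorphic_maps_sym by blast
  ultimately show ?thesis
    using assms(2) by (intro rel_homeomorphicI[of Y X h' h]) (auto simp: h(2))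
qed

lemma class4_code_homeomorphic:
  assumes "class4_code Y F" "rel_homeomorphic X E Y F"
  shows "class4_code X E"
proof -
  have YS: "homeomorphic_maps Y (sum_topology (\<lambda>_. Y) {0}) (\<lambda>x. (0 :: nat, x)) snd"
    unfolding homeomorphic_maps_def
  proof (intro conjI)
    show "continuous_map Y (sum_topology (\<lambda>_. Y) {0}) (\<lambda>x. (0 :: nat, x))"
      using continuous_map_component_injection[of 0 "{0 :: nat}" "\<lambda>_. Y"] by simp
    have eq: "{x. (0 :: nat, x) \<in> {z \<in> Sigma {0} (topspace \<circ> (\<lambda>_. Y)). snd z \<in> U}} = U"
      if "openin Y U" for U
      using openin_subset[OF that] by auto
    show "continuous_map (sum_topology (\<lambda>_. Y) {0 :: nat}) Y snd"
      unfolding continuous_map_def openin_sum_topology topspace_sum_topology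
    proof (intro conjI allI impI ballI)
      fix U and i :: nat
      assume "openin Y U" and "i \<in> {0}"
      then show "openin Y {x. (i, x) \<in> {z \<in> Sigma {0} (topspace \<circ> (\<lambda>_. Y)). snd z \<in> U}}"
        using eq by simp
    qed auto
  qed auto
  obtain h where h: "homeomorphic_map X Y h"
    "E = {(x, y). x \<in> topspace X \<and> y \<in> topspace X \<and> (h x, h y) \<in> F}"
    using assms unfolding rel_homeomorphic_def by auto
  have "homeomorphic_map X (sum_topology (\<lambda>_. Y) {0}) ((\<lambda>x. (0 :: nat, x)) \<circ> h)"
    using homeomorphic_map_compose h(1) YS homeomorphic_maps_map by blast
  then have "rel_homeomorphic X E (sum_topology (\<lambda>_. Y) {0}) (disjoint_sum_rel {0} (\<lambda>_. F))"
    unfolding rel_homeomorphic_def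
    by (intro exI[of _ "(\<lambda>x. (0 :: nat, x)) \<circ> h"] conjI) (auto simp: h(2) disjoint_sum_rel_def)
  then show ?thesis
    using class4_code.disjoint_sum[of "{0}" "\<lambda>_. Y" "\<lambda>_. F" X E] assms(1) by simp
qed

lemma class4_homeomorphic:
  assumes "class4 Y F" "rel_homeomorphic X E Y F"
  shows "class4 X E"
  using assms rel_homeomorphic_trans unfolding class4_def by blast

lemma class4_subset: "class4 X E \<Longrightarrow> E \<subseteq> topspace X \<times> topspace X"
  unfolding class4_def rel_homeomorphic_def by auto

lemma class4_code_imp_class4:
  assumes "class4_code X E"
  shows "class4 X E"
proof -
  have sub: "E \<subseteq> topspace X \<times> topspace X"
    using assms
  proof (induction rule: class4_code.induct)
    case (equality X) then show ?case by auto
  next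
    case (union X E) then show ?case by blast
  next
    case (intersection X E) then show ?case by blast
  qed (auto simp: rel_homeomorphic_def)
  have "rel_homeomorphic X E X E"
    by (rule rel_homeomorphicI[of X X id id]) (use sub homeomorphic_maps_id in auto)
  then show ?thesis using assms class4_def by blast
qed

lemma class4_nat_set: "class4 X E \<longleftrightarrow> class4_code X E" for X :: "nat set topology"
  using class4_code_imp_class4 class4_code_homeomorphic class4_def by blast

lemma class4_transfer:
  fixes X :: "'a topology" and X' :: "'b topology"
  assumes "class4 X E" "homeomorphic_maps X X' g g'"
  shows "class4 X' {(x, y). x \<in> topspace X' \<and> y \<in> topspace X' \<and> (g' x, g' y) \<in> E}"
proof (rule class4_homeomorphic[OF assms(1)])
  have "homeomorphic_map X' X g'" using assms(2) homeomorphic_maps_map by blast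
  then show "rel_homeomorphic X' {(x, y). x \<in> topspace X' \<and> y \<in> topspace X' \<and> (g' x, g' y) \<in> E} X E"
    unfolding rel_homeomorphic_def by blast
qed

lemma class4_inj:
  fixes X :: "'a topology"
  assumes "class4 X E"
  obtains g :: "'a \<Rightarrow> nat set" where "inj_on g (topspace X)"
  using assms homeomorphic_imp_injective_map unfolding class4_def rel_homeomorphic_def by metis

lemma class4_copy:
  fixes X :: "'a topology"
  assumes "class4 X E"
  obtains X' :: "nat set topology" and E' g g' where "class4_code X' E'"
    "homeomorphic_maps X X' g g'"
    "\<forall>x\<in>topspace X. \<forall>y\<in>topspace X. (x, y) \<in> E \<longleftrightarrow> (g x, g y) \<in> E'"
proof -
  obtain X' :: "nat set topology" and E' where X': "class4_code X' E'" "rel_homeomorphic X E X' E'"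
    using assms class4_def by blast
  then obtain g where "homeomorphic_map X X' g"
    "E = {(x, y). x \<in> topspace X \<and> y \<in> topspace X \<and> (g x, g y) \<in> E'}"
    unfolding rel_homeomorphic_def by blast
  then show ?thesis using X' that homeomorphic_map_maps by blast
qed

text \<open>A rule whose conclusion holds for all copies on \<^typ>\<open>nat set\<close> holds outright.\<close>

lemma class4_of_copies:
  fixes P :: "'a topology" and P' :: "'b topology" and g :: "'b \<Rightarrow> nat set"
  assumes code: "\<And>X E. rel_homeomorphic X E P' R' \<Longrightarrow> class4_code X E"
    and R: "rel_homeomorphic P R P' R'" and R': "R' \<subseteq> topspace P' \<times> topspace P'"
    and g: "inj_on g (topspace P')"
  shows "class4 P R"
proof -
  obtain X g' where X: "homeomorphic_maps P' X g g'"
    using homeomorphic_copy[OF g] by blast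
  let ?E = "{(x, y). x \<in> topspace X \<and> y \<in> topspace X \<and> (g' x, g' y) \<in> R'}"
  have XE: "rel_homeomorphic X ?E P' R'"
    using X homeomorphic_maps_map unfolding rel_homeomorphic_def by blast
  then have "rel_homeomorphic P' R' X ?E"
    using R' rel_homeomorphic_sym by blast
  then show ?thesis
    unfolding class4_def using code[OF XE] R rel_homeomorphic_trans by blast
qed

lemma inj_product_nat_set:
  fixes Y :: "nat \<Rightarrow> nat set topology"
  obtains g :: "(nat \<Rightarrow> nat set) \<Rightarrow> nat set" where "inj_on g (topspace (product_topology Y I))"
proof
  let ?g = "\<lambda>x :: nat \<Rightarrow> nat set. prod_encode ` {(k, n). n \<in> x k}"
  have "x = y" if "?g x = ?g y" for x y
  proof -
    have "{(k, n). n \<in> x k} = {(k, n). n \<in> y k}"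
      by (rule iffD1[OF inj_image_eq_iff[OF inj_prod_encode] that])
    then have "n \<in> x k \<longleftrightarrow> n \<in> y k" for k n by blast
    then show ?thesis by (intro ext set_eqI)
  qed
  then show "inj_on ?g (topspace (product_topology Y I))"
    by (intro inj_onI)
qed

lemma homeomorphic_maps_product:
  assumes "\<And>k. k \<in> I \<Longrightarrow> homeomorphic_maps (Y k) (Y' k) (g k) (g' k)"
  shows "homeomorphic_maps (product_topology Y I) (product_topology Y' I)
           (\<lambda>x. \<lambda>k\<in>I. g k (x k)) (\<lambda>x. \<lambda>k\<in>I. g' k (x k))"
proof -
  have cont: "continuous_map (product_topology A I) (product_topology B I) (\<lambda>x. \<lambda>k\<in>I. f k (x k))"
    if "\<And>k. k \<in> I \<Longrightarrow> continuous_map (A k) (B k) (f k)" for A B f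
    unfolding continuous_map_componentwise
  proof (intro conjI ballI)
    fix k assume k: "k \<in> I"
    have "continuous_map (product_topology A I) (B k) (f k \<circ> (\<lambda>x. x k))"
      using k that by (intro continuous_map_compose[of _ "A k" "\<lambda>x. x k"] continuous_map_product_projection)
    then show "continuous_map (product_topology A I) (B k) (\<lambda>x. (\<lambda>k\<in>I. f k (x k)) k)"
      using k by (simp add: o_def)
  qed auto
  show ?thesis
    unfolding homeomorphic_maps_def
    using assms unfolding homeomorphic_maps_def
    by (intro conjI cont ballI) (auto simp: PiE_iff extensional_def fun_eq_iff)
qed

theorem class4_equality:
  assumes "polish_space X"
  shows "class4 X (Id_on (topspace X))"
proof -
  obtain g :: "'a \<Rightarrow> nat set" where "inj_on g (topspace X)"
    using polish_space_inj[OF assms] .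
  then obtain X' g' where X': "homeomorphic_maps X X' g g'"
    using homeomorphic_copy by blast
  then have sp: "X homeomorphic_space X'" unfolding homeomorphic_space_def by blast
  have "polish_space X'"
    using assms homeomorphic_completely_metrizable_space[OF sp] homeomorphic_separable_space[OF sp]
    unfolding polish_space_def by blast
  then have "class4_code X' (Id_on (topspace X'))" by (rule class4_code.equality)
  moreover have "rel_homeomorphic X (Id_on (topspace X)) X' (Id_on (topspace X'))"
    using X' by (intro rel_homeomorphicI) (auto simp: homeomorphic_maps_def continuous_map_def Id_on_iff, metis)
  ultimately show ?thesis unfolding class4_def by blast
qed

lemma class4_common_copy:
  fixes X :: "'a topology" and E :: "nat \<Rightarrow> ('a \<times> 'a) set"
  assumes "\<And>k. class4 X (E k)"
  obtains X' :: "nat set topology" and g g' where "homeomorphic_maps X X' g g'"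
    "\<forall>k. class4_code X' {(x, y). x \<in> topspace X' \<and> y \<in> topspace X' \<and> (g' x, g' y) \<in> E k}"
proof -
  obtain g :: "'a \<Rightarrow> nat set" where "inj_on g (topspace X)"
    using class4_inj[OF assms] .
  then obtain X' g' where X': "homeomorphic_maps X X' g g'"
    using homeomorphic_copy by blast
  show ?thesis
    by (rule that[OF X']) (use class4_transfer[OF assms X'] class4_nat_set in blast)
qed

theorem class4_union:
  fixes E :: "nat \<Rightarrow> ('a \<times> 'a) set"
  assumes "\<And>k. class4 X (E k)" "equiv (topspace X) (\<Union>k. E k)"
  shows "class4 X (\<Union>k. E k)"
proof -
  obtain X' :: "nat set topology" and g g' where X': "homeomorphic_maps X X' g g'"
    "\<forall>k. class4_code X' {(x, y). x \<in> topspace X' \<and> y \<in> topspace X' \<and> (g' x, g' y) \<in> E k}"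
    using class4_common_copy[of X E, OF assms(1)] .
  define E' where E': "E' k = {(x, y). x \<in> topspace X' \<and> y \<in> topspace X' \<and> (g' x, g' y) \<in> E k}" for k
  have code: "class4_code X' (E' k)" for k using X'(2) unfolding E' by blast
  have maps: "g x \<in> topspace X' \<and> g' (g x) = x" if "x \<in> topspace X" for x
    using X'(1) that unfolding homeomorphic_maps_def continuous_map_def by auto
  have maps': "g' x \<in> topspace X" if "x \<in> topspace X'" for x
    using X'(1) that unfolding homeomorphic_maps_def continuous_map_def by auto
  have eq: "(\<Union>k. E' k) = {(x, y). x \<in> topspace X' \<and> y \<in> topspace X' \<and> (g' x, g' y) \<in> (\<Union>k. E k)}"
    unfolding E' by auto
  have "equiv (topspace X') (\<Union>k. E' k)"
  proof (rule equivI)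
    show "refl_on (topspace X') (\<Union>k. E' k)"
      using assms(2) maps' unfolding eq equiv_def refl_on_def by auto
    show "sym (\<Union>k. E' k)"
      using assms(2) unfolding eq equiv_def sym_def by auto
    show "trans (\<Union>k. E' k)"
      using assms(2) unfolding eq equiv_def trans_def by blast
  qed (auto simp: eq)
  then have "class4_code X' (\<Union>k. E' k)" using code class4_code.union by blast
  moreover have "rel_homeomorphic X (\<Union>k. E k) X' (\<Union>k. E' k)"
    using X'(1) class4_subset[OF assms(1)] maps by (intro rel_homeomorphicI) (auto simp: eq)
  ultimately show ?thesis unfolding class4_def by blast
qed

theorem class4_intersection:
  fixes E :: "nat \<Rightarrow> ('a \<times> 'a) set"
  assumes "\<And>k. class4 X (E k)"
  shows "class4 X (\<Inter>k. E k)"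
proof -
  obtain X' :: "nat set topology" and g g' where X': "homeomorphic_maps X X' g g'"
    "\<forall>k. class4_code X' {(x, y). x \<in> topspace X' \<and> y \<in> topspace X' \<and> (g' x, g' y) \<in> E k}"
    using class4_common_copy[of X E, OF assms(1)] .
  define E' where E': "E' k = {(x, y). x \<in> topspace X' \<and> y \<in> topspace X' \<and> (g' x, g' y) \<in> E k}" for k
  have code: "class4_code X' (E' k)" for k using X'(2) unfolding E' by blast
  have maps: "g x \<in> topspace X' \<and> g' (g x) = x" if "x \<in> topspace X" for x
    using X'(1) that unfolding homeomorphic_maps_def continuous_map_def by auto
  have "class4_code X' (\<Inter>k. E' k)" using code class4_code.intersection by blast
  moreover have "rel_homeomorphic X (\<Inter>k. E k) X' (\<Inter>k. E' k)"
  proof (rule rel_homeomorphicI[OF X'(1)])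
    show "(\<Inter>k. E k) \<subseteq> topspace X \<times> topspace X"
      using class4_subset[OF assms, of 0] by blast
  qed (use maps in \<open>auto simp: E'\<close>)
  ultimately show ?thesis unfolding class4_def by blast
qed

lemma class4_copies:
  fixes Y :: "nat \<Rightarrow> 'a topology"
  assumes "\<And>k. k \<in> I \<Longrightarrow> class4 (Y k) (F k)"
  obtains Y' :: "nat \<Rightarrow> nat set topology" and F' g g' where
    "\<forall>k\<in>I. class4_code (Y' k) (F' k) \<and> homeomorphic_maps (Y k) (Y' k) (g k) (g' k) \<and>
       (\<forall>x\<in>topspace (Y k). \<forall>y\<in>topspace (Y k). (x, y) \<in> F k \<longleftrightarrow> (g k x, g k y) \<in> F' k)"
proof -
  have "\<exists>Y' :: nat set topology. \<exists>F' g g'. class4_code Y' F' \<and> homeomorphic_maps (Y k) Y' g g' \<and>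
      (\<forall>x\<in>topspace (Y k). \<forall>y\<in>topspace (Y k). (x, y) \<in> F k \<longleftrightarrow> (g x, g y) \<in> F')" if "k \<in> I" for k
    using class4_copy[OF assms[OF that]] by metis
  then show ?thesis using that by metis
qed

theorem class4_disjoint_sum:
  fixes Y :: "nat \<Rightarrow> 'a topology"
  assumes "\<And>k. k \<in> I \<Longrightarrow> class4 (Y k) (F k)"
  shows "class4 (sum_topology Y I) (disjoint_sum_rel I F)"
proof -
  obtain Y' :: "nat \<Rightarrow> nat set topology" and F' g g' where
    copies: "\<forall>k\<in>I. class4_code (Y' k) (F' k) \<and> homeomorphic_maps (Y k) (Y' k) (g k) (g' k) \<and>
       (\<forall>x\<in>topspace (Y k). \<forall>y\<in>topspace (Y k). (x, y) \<in> F k \<longleftrightarrow> (g k x, g k y) \<in> F' k)"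
    using class4_copies[of I Y F, OF assms] .
  have code: "class4_code (Y' k) (F' k)" and maps: "homeomorphic_maps (Y k) (Y' k) (g k) (g' k)"
    and F': "\<And>x y. \<lbrakk>x \<in> topspace (Y k); y \<in> topspace (Y k)\<rbrakk> \<Longrightarrow> (x, y) \<in> F k \<longleftrightarrow> (g k x, g k y) \<in> F' k"
    if "k \<in> I" for k
    using copies that by blast+
  have cont: "continuous_map (sum_topology A I) (sum_topology B I) (\<lambda>(k, x). (k, f k x))"
    if f: "\<And>k. k \<in> I \<Longrightarrow> continuous_map (A k) (B k) (f k)"
    for A :: "nat \<Rightarrow> 'c topology" and B :: "nat \<Rightarrow> 'd topology" and f
    unfolding continuous_map_def openin_sum_topology topspace_sum_topology
  proof (intro conjI allI impI ballI)
    show "(\<lambda>(k, x). (k, f k x)) \<in> Sigma I (topspace \<circ> A) \<rightarrow> Sigma I (topspace \<circ> B)"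
      using continuous_map_image_subset_topspace[OF f] by fastforce
    fix U k
    assume U: "U \<subseteq> Sigma I (topspace \<circ> B) \<and> (\<forall>i\<in>I. openin (B i) {x. (i, x) \<in> U})" and k: "k \<in> I"
    have "openin (A k) {x \<in> topspace (A k). f k x \<in> {y. (k, y) \<in> U}}"
      by (rule openin_continuous_map_preimage[OF f[OF k]]) (use U k in blast)
    then show "openin (A k) {x. (k, x) \<in> {z \<in> Sigma I (topspace \<circ> A). (case z of (k, x) \<Rightarrow> (k, f k x)) \<in> U}}"
      using k by simp
  qed auto
  have hom: "homeomorphic_maps (sum_topology Y I) (sum_topology Y' I)
      (\<lambda>(k, x). (k, g k x)) (\<lambda>(k, x). (k, g' k x))"
    using maps unfolding homeomorphic_maps_def by (intro conjI cont) auto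
  have sub: "F' k \<subseteq> topspace (Y' k) \<times> topspace (Y' k)" if "k \<in> I" for k
    using class4_subset[OF class4_code_imp_class4[OF code[OF that]]] .
  have rel: "rel_homeomorphic (sum_topology Y I) (disjoint_sum_rel I F)
      (sum_topology Y' I) (disjoint_sum_rel I F')"
  proof (rule rel_homeomorphicI[OF hom])
    have "F k \<subseteq> topspace (Y k) \<times> topspace (Y k)" if "k \<in> I" for k
      using class4_subset[OF assms[OF that]] .
    then show "disjoint_sum_rel I F \<subseteq> topspace (sum_topology Y I) \<times> topspace (sum_topology Y I)"
      unfolding disjoint_sum_rel_def by fastforce
  qed (use F' in \<open>auto simp: disjoint_sum_rel_def\<close>)
  have inj: "inj_on (\<lambda>(k, x). prod_encode ` ({k} \<times> insert 0 (Suc ` x))) (topspace (sum_topology Y' I))"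
  proof (rule inj_onI, clarify)
    fix k l :: nat and x y :: "nat set"
    assume "prod_encode ` ({k} \<times> insert 0 (Suc ` x)) = prod_encode ` ({l} \<times> insert 0 (Suc ` y))"
    then have eq: "{k} \<times> insert 0 (Suc ` x) = {l} \<times> insert 0 (Suc ` y)"
      by (rule iffD1[OF inj_image_eq_iff[OF inj_prod_encode]])
    have "(k, 0) \<in> {l} \<times> insert 0 (Suc ` y)" unfolding eq[symmetric] by simp
    then have "k = l" by simp
    moreover have "n \<in> x \<longleftrightarrow> n \<in> y" for n
    proof -
      have "n \<in> x \<longleftrightarrow> (k, Suc n) \<in> {k} \<times> insert 0 (Suc ` x)" by (simp add: image_iff)
      also have "\<dots> \<longleftrightarrow> n \<in> y" unfolding eq using \<open>k = l\<close> by (simp add: image_iff)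
      finally show ?thesis .
    qed
    ultimately show "k = l \<and> x = y" by (intro conjI set_eqI)
  qed
  have subset: "disjoint_sum_rel I F' \<subseteq> topspace (sum_topology Y' I) \<times> topspace (sum_topology Y' I)"
    unfolding disjoint_sum_rel_def using sub by fastforce
  show ?thesis
    by (rule class4_of_copies[OF class4_code.disjoint_sum[OF code] rel subset inj])
qed

theorem class4_product:
  fixes Y :: "nat \<Rightarrow> 'a topology"
  assumes "\<And>k. k \<in> I \<Longrightarrow> class4 (Y k) (F k)"
  shows "class4 (product_topology Y I) (product_rel I Y F)"
proof -
  obtain Y' :: "nat \<Rightarrow> nat set topology" and F' g g' where
    copies: "\<forall>k\<in>I. class4_code (Y' k) (F' k) \<and> homeomorphic_maps (Y k) (Y' k) (g k) (g' k) \<and>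
       (\<forall>x\<in>topspace (Y k). \<forall>y\<in>topspace (Y k). (x, y) \<in> F k \<longleftrightarrow> (g k x, g k y) \<in> F' k)"
    using class4_copies[of I Y F, OF assms] .
  have code: "class4_code (Y' k) (F' k)" and maps: "homeomorphic_maps (Y k) (Y' k) (g k) (g' k)"
    and F': "\<And>x y. \<lbrakk>x \<in> topspace (Y k); y \<in> topspace (Y k)\<rbrakk> \<Longrightarrow> (x, y) \<in> F k \<longleftrightarrow> (g k x, g k y) \<in> F' k"
    if "k \<in> I" for k
    using copies that by blast+
  have mem: "g k x \<in> topspace (Y' k)" if "k \<in> I" "x \<in> topspace (Y k)" for k x
    using maps[OF that(1)] that(2) unfolding homeomorphic_maps_def continuous_map_def by auto
  have rel: "rel_homeomorphic (product_topology Y I) (product_rel I Y F)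
      (product_topology Y' I) (product_rel I Y' F')"
    using F' mem by (intro rel_homeomorphicI[OF homeomorphic_maps_product[OF maps]])
      (auto simp: product_rel_def PiE_iff extensional_def)
  obtain i :: "(nat \<Rightarrow> nat set) \<Rightarrow> nat set" where inj: "inj_on i (topspace (product_topology Y' I))"
    using inj_product_nat_set .
  show ?thesis
    by (rule class4_of_copies[OF class4_code.product[OF code] rel _ inj]) (auto simp: product_rel_def)
qed

theorem class4_fubini:
  fixes Y :: "nat \<Rightarrow> 'a topology"
  assumes "\<And>k. class4 (Y k) (F k)"
  shows "class4 (product_topology Y UNIV) (fubini_rel Y F)"
proof -
  obtain Y' :: "nat \<Rightarrow> nat set topology" and F' g g' where
    copies: "\<forall>k\<in>UNIV. class4_code (Y' k) (F' k) \<and> homeomorphic_maps (Y k) (Y' k) (g k) (g' k) \<and>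
       (\<forall>x\<in>topspace (Y k). \<forall>y\<in>topspace (Y k). (x, y) \<in> F k \<longleftrightarrow> (g k x, g k y) \<in> F' k)"
    using class4_copies[of UNIV Y F, OF assms] .
  have code: "class4_code (Y' k) (F' k)" and maps: "homeomorphic_maps (Y k) (Y' k) (g k) (g' k)"
    and F': "\<And>x y. \<lbrakk>x \<in> topspace (Y k); y \<in> topspace (Y k)\<rbrakk> \<Longrightarrow> (x, y) \<in> F k \<longleftrightarrow> (g k x, g k y) \<in> F' k" for k
    using copies by blast+
  have mem: "g k x \<in> topspace (Y' k)" if "x \<in> topspace (Y k)" for k x
    using maps[of k] that unfolding homeomorphic_maps_def continuous_map_def by blast
  have rel: "rel_homeomorphic (product_topology Y UNIV) (fubini_rel Y F)
      (product_topology Y' UNIV) (fubini_rel Y' F')"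
    using F' mem by (intro rel_homeomorphicI[OF homeomorphic_maps_product[OF maps]])
      (auto simp: fubini_rel_def PiE_iff)
  obtain i :: "(nat \<Rightarrow> nat set) \<Rightarrow> nat set" where inj: "inj_on i (topspace (product_topology Y' UNIV))"
    using inj_product_nat_set .
  show ?thesis
    by (rule class4_of_copies[OF class4_code.fubini[OF code] rel _ inj]) (auto simp: fubini_rel_def)
qed

theorem class4_power:
  fixes Y :: "'a topology"
  assumes "class4 Y F"
  shows "class4 (product_topology (\<lambda>_. Y) UNIV) (countable_power_rel Y F)"
proof -
  obtain Y' :: "nat set topology" and F' g g' where
    code: "class4_code Y' F'" and maps: "homeomorphic_maps Y Y' g g'"
    and F': "\<forall>x\<in>topspace Y. \<forall>y\<in>topspace Y. (x, y) \<in> F \<longleftrightarrow> (g x, g y) \<in> F'"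
    using class4_copy[OF assms] .
  have mem: "g x \<in> topspace Y'" if "x \<in> topspace Y" for x
    using maps that unfolding homeomorphic_maps_def continuous_map_def by auto
  have rel: "rel_homeomorphic (product_topology (\<lambda>_. Y) UNIV) (countable_power_rel Y F)
      (product_topology (\<lambda>_. Y') UNIV) (countable_power_rel Y' F')"
    using F' mem by (intro rel_homeomorphicI[OF homeomorphic_maps_product[OF maps]])
      (auto simp: countable_power_rel_def PiE_iff)
  obtain i :: "(nat \<Rightarrow> nat set) \<Rightarrow> nat set"
    where inj: "inj_on i (topspace (product_topology (\<lambda>_. Y') UNIV))"
    using inj_product_nat_set .
  show ?thesis
    by (rule class4_of_copies[OF class4_code.power[OF code] rel _ inj])
      (auto simp: countable_power_rel_def)
qed

end

theory Submission
  imports Defs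
begin

text \<open>Two facts combine. First, write the Borel set \<open>Z\<close> as a projection of a closed set. Since \<open>Z\<close> is
  directed modulo finite sets for countable families, one can keep only the pieces that are cofinal
  in \<open>Z\<close>, and this yields a dichotomy: either \<open>Z\<close> consists of the sets almost disjoint from
  countably many given ones, which leaves only \<open>UNIV\<close>, \<open>Fin\<close>, its trivial variations and \<open>I3\<close>, or
  the restriction of \<open>Z\<close> to some \<open>x \<notin> Z\<close> is tall, i.e. every infinite subset of \<open>x\<close> contains an
  infinite member of \<open>Z\<close>.

  Second, for a tall P-ideal \<open>I\<close>, every relation \<open>F\<close> of Class 4 has the property that a Baire
  measurable map that is \<open>F\<close>-invariant under \<open>I\<close> is generically constant modulo \<open>F\<close>. No Polish
  topology on \<open>I\<close> is needed for this: invariance is expressed through generic elements of the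
  compact groups \<open>Pow y\<close>, \<open>y \<in> I\<close>. If \<open>F\<close> is a countable union, one member of the union works on a
  piece for each \<open>y\<close>, by directedness a fixed one works for cofinally many \<open>y\<close>, and tallness extends
  this to all \<open>y\<close>. For a reduction, generic constancy would make an \<open>I\<close>-class comeager, which is
  impossible for a proper ideal.\<close>

section \<open>Baire category on sequence spaces\<close>

definition cyl :: "(nat \<Rightarrow> 'a) \<Rightarrow> nat \<Rightarrow> (nat \<Rightarrow> 'a) set" where
  "cyl p n = {q. \<forall>i<n. q i = p i}"

definition nowhere_dense :: "(nat \<Rightarrow> 'a) set \<Rightarrow> bool" where
  "nowhere_dense A \<longleftrightarrow> (\<forall>p n. \<exists>q m. q \<in> cyl p n \<and> n \<le> m \<and> cyl q m \<inter> A = {})"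

definition meager :: "(nat \<Rightarrow> 'a) set \<Rightarrow> bool" where
  "meager A \<longleftrightarrow> (\<exists>N :: nat \<Rightarrow> _. (\<forall>i. nowhere_dense (N i)) \<and> A \<subseteq> (\<Union>i. N i))"

lemma self_in_cyl [simp]: "p \<in> cyl p n"
  by (simp add: cyl_def)

lemma cyl_0 [simp]: "cyl p 0 = UNIV"
  by (simp add: cyl_def)

lemma cyl_mono: "q \<in> cyl p n \<Longrightarrow> n \<le> m \<Longrightarrow> cyl q m \<subseteq> cyl p n"
  by (auto simp: cyl_def)

lemma cyl_eq: "q \<in> cyl p n \<Longrightarrow> cyl q n = cyl p n"
  by (auto simp: cyl_def)

text \<open>Completeness of the sequence space: every coordinate is eventually frozen, because the
  lengths \<open>m i\<close> grow strictly.\<close>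

lemma cyl_limit:
  assumes q: "\<And>i. q (Suc i) \<in> cyl (q i) (m i)" and m: "\<And>i. m i < m (Suc i)"
  obtains r where "\<And>i. r \<in> cyl (q i) (m i)"
proof -
  have stable: "q (i + j) k = q i k" if "k < m i" for i j k
  proof (induction j)
    case (Suc j)
    have "m i \<le> m (i + j)"
      using m by (simp add: lift_Suc_mono_le less_imp_le)
    then show ?case
      using q[of "i + j"] that Suc by (auto simp: cyl_def)
  qed simp
  have ge: "k \<le> m k" for k
    using m by (simp add: strict_mono_imp_increasing strict_mono_Suc_iff)
  \<comment> \<open>Stage \<open>Suc k\<close> is needed: \<open>k < m (Suc k)\<close> always holds,
    while \<open>m k\<close> may equal \<open>k\<close>.\<close>
  have "(\<lambda>k. q (Suc k) k) \<in> cyl (q i) (m i)" for i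
  proof -
    have "q (Suc k) k = q i k" if "k < m i" for k
    proof (cases "i \<le> Suc k")
      case True
      then show ?thesis using stable[OF that, of "Suc k - i"] by simp
    next
      case False
      have "k < m (Suc k)" using ge[of "Suc k"] by simp
      then show ?thesis using stable[of k "Suc k" "i - Suc k"] False by simp
    qed
    then show ?thesis by (simp add: cyl_def)
  qed
  then show ?thesis by (rule that)
qed

lemma meager_mono: "meager A \<Longrightarrow> B \<subseteq> A \<Longrightarrow> meager B"
  unfolding meager_def by blast

lemma nowhere_dense_imp_meager: "nowhere_dense A \<Longrightarrow> meager A"
  unfolding meager_def by (rule exI[of _ "\<lambda>_. A"]) auto

lemma meager_empty [simp]: "meager {}"
  by (rule nowhere_dense_imp_meager) (auto simp: nowhere_dense_def intro: self_in_cyl)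

lemma meager_UN_nat:
  assumes "\<And>i :: nat. meager (A i)"
  shows "meager (\<Union>i. A i)"
proof -
  obtain N where N: "\<And>i j. nowhere_dense (N i j)" "\<And>i. A i \<subseteq> (\<Union>j :: nat. N i j)"
    using assms unfolding meager_def by metis
  define N' where "N' k = (case prod_decode k of (i, j) \<Rightarrow> N i j)" for k
  have "(\<Union>i. A i) \<subseteq> (\<Union>k. N' k)"
  proof (rule UN_least)
    fix i
    have "N i j \<subseteq> (\<Union>k. N' k)" for j
      using UN_upper[of "prod_encode (i, j)" UNIV N'] by (simp add: N'_def)
    then show "A i \<subseteq> (\<Union>k. N' k)" by (intro order_trans[OF N(2)] UN_least)
  qed
  moreover have "nowhere_dense (N' k)" for k
    using N(1) by (simp add: N'_def split: prod.split)
  ultimately show ?thesis unfolding meager_def by blast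
qed

lemma meager_UN:
  fixes A :: "'c :: countable \<Rightarrow> _"
  assumes "\<And>i. i \<in> J \<Longrightarrow> meager (A i)"
  shows "meager (\<Union>i\<in>J. A i)"
proof -
  define B where "B k = (if from_nat k \<in> J then A (from_nat k) else {})" for k
  have "meager (\<Union>k. B k)" by (rule meager_UN_nat) (simp add: B_def assms)
  moreover have "A i \<subseteq> (\<Union>k. B k)" if "i \<in> J" for i
    using UN_upper[of "to_nat i" UNIV B] that by (simp add: B_def)
  ultimately show ?thesis by (meson UN_least meager_mono)
qed

lemma meager_Un:
  assumes "meager A" "meager B"
  shows "meager (A \<union> B)"
proof -
  have "meager (\<Union>b\<in>UNIV. if b then A else B)" by (rule meager_UN) (simp add: assms)
  then show ?thesis by (rule meager_mono) (auto split: if_splits)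
qed

text \<open>Dependent choice for shrinking cylinders, combined with passage to the limit point.
  \<open>P\<close> is the invariant and \<open>Q\<close> records what a step achieves; both the
  Baire category theorem and the dichotomy for analytic P-ideals run on it.\<close>

lemma cyl_recursion:
  assumes "P q0"
    and step: "\<And>i q m. P q \<Longrightarrow> \<exists>q' m'. P q' \<and> q' \<in> cyl q m \<and> m < m' \<and> Q i m q' m'"
  obtains q m r where "q 0 = q0" "m 0 = m0" "\<And>i :: nat. P (q i)"
    "\<And>i. Q i (m i) (q (Suc i)) (m (Suc i))" "\<And>i. m i < m (Suc i)" "\<And>i. r \<in> cyl (q i) (m i)"
proof -
  define R where "R i z z' \<longleftrightarrow>
    fst z' \<in> cyl (fst z) (snd z) \<and> snd z < snd z' \<and> Q i (snd z) (fst z') (snd z')" for i z z'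
  have "\<exists>f. \<forall>i :: nat. (P (fst (f i)) \<and> (i = 0 \<longrightarrow> f i = (q0, m0))) \<and> R i (f i) (f (Suc i))"
  proof (rule dependent_nat_choice)
    show "\<exists>z. P (fst z) \<and> ((0 :: nat) = 0 \<longrightarrow> z = (q0, m0))"
      by (rule exI[of _ "(q0, m0)"]) (simp add: assms(1))
    fix z and i :: nat assume "P (fst z) \<and> (i = 0 \<longrightarrow> z = (q0, m0))"
    then obtain q' m' where "P q'" "q' \<in> cyl (fst z) (snd z)" "snd z < m'" "Q i (snd z) q' m'"
      using step by meson
    then show "\<exists>z'. (P (fst z') \<and> (Suc i = 0 \<longrightarrow> z' = (q0, m0))) \<and> R i z z'"
      by (intro exI[of _ "(q', m')"]) (simp add: R_def)
  qed
  then obtain f where f: "\<And>i :: nat. P (fst (f i))" "f 0 = (q0, m0)" "\<And>i. R i (f i) (f (Suc i))"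
    by blast
  obtain r where r: "\<And>i. r \<in> cyl (fst (f i)) (snd (f i))"
    using cyl_limit[of "\<lambda>i. fst (f i)" "\<lambda>i. snd (f i)"] f(3) unfolding R_def by blast
  show ?thesis
    by (rule that[of "\<lambda>i. fst (f i)" "\<lambda>i. snd (f i)" r]) (use f r R_def in auto)
qed

theorem baire_cyl:
  assumes "meager A"
  obtains q where "q \<in> cyl p n" "q \<notin> A"
proof -
  obtain N where N: "\<And>i :: nat. nowhere_dense (N i)" "A \<subseteq> (\<Union>i. N i)"
    using assms unfolding meager_def by blast
  have step: "\<exists>q' m'. q' \<in> cyl q m \<and> m < m' \<and> cyl q' m' \<inter> N i = {}" for q m i
  proof -
    obtain q' m' where "q' \<in> cyl q m" "m \<le> m'" "cyl q' m' \<inter> N i = {}"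
      using N(1)[of i] unfolding nowhere_dense_def by meson
    moreover have "cyl q' (Suc m') \<subseteq> cyl q' m'" by (rule cyl_mono) auto
    \<comment> \<open>Nowhere density gives only \<open>m \<le> m'\<close>; \<open>Suc m'\<close>
      makes the lengths grow strictly.\<close>
    ultimately show ?thesis by (intro exI[of _ q'] exI[of _ "Suc m'"]) auto
  qed
  obtain f m r where r: "f 0 = p" "m 0 = n" "\<And>i. cyl (f (Suc i)) (m (Suc i)) \<inter> N i = {}"
    "\<And>i. r \<in> cyl (f i) (m i)"
    by (rule cyl_recursion[of "\<lambda>_. True" p "\<lambda>i m q' m'. cyl q' m' \<inter> N i = {}" n])
      (use step in blast)+
  have "r \<notin> N i" for i using r(3)[of i] r(4)[of "Suc i"] by blast
  then have "r \<notin> A" using N(2) by blast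
  moreover have "r \<in> cyl p n" using r(1,2) r(4)[of 0] by simp
  ultimately show ?thesis using that by blast
qed

section \<open>Coordinatewise surjections as changes of variables\<close>

definition coordmap :: "(nat \<Rightarrow> 'a \<Rightarrow> 'b) \<Rightarrow> (nat \<Rightarrow> 'a) \<Rightarrow> nat \<Rightarrow> 'b" where
  "coordmap h p = (\<lambda>i. h i (p i))"

text \<open>Such a map is open: from \<open>n\<close> on, preimages are chosen coordinate by
  coordinate, and below \<open>n\<close> those of \<open>p\<close> are kept. Openness is why it
  pulls meager sets back to meager sets.\<close>

lemma coordmap_cyl:
  assumes h: "\<And>i. surj (h i)"
  shows "coordmap h ` cyl p n = cyl (coordmap h p) n"
proof (intro equalityI subsetI)
  fix q assume q: "q \<in> cyl (coordmap h p) n"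
  have "\<exists>q'. \<forall>i. h i (q' i) = q i \<and> (i < n \<longrightarrow> q' i = p i)"
  proof (rule choice, rule allI)
    fix i
    show "\<exists>a. h i a = q i \<and> (i < n \<longrightarrow> a = p i)"
    proof (cases "i < n")
      case True
      then show ?thesis using q by (intro exI[of _ "p i"]) (simp add: cyl_def coordmap_def)
    next
      case False
      obtain a where "q i = h i a" using h[of i] by (rule surjE)
      then show ?thesis using False by (intro exI[of _ a]) simp
    qed
  qed
  then obtain q' where "\<forall>i. h i (q' i) = q i \<and> (i < n \<longrightarrow> q' i = p i)" by blast
  then show "q \<in> coordmap h ` cyl p n"
    by (intro image_eqI[of _ _ q']) (auto simp: coordmap_def cyl_def)
qed (auto simp: cyl_def coordmap_def)

lemma coordmap_cyl_lift:
  assumes "\<And>i. surj (h i)" "q \<in> cyl (coordmap h p) n"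
  obtains q' where "q' \<in> cyl p n" "coordmap h q' = q"
  using assms(2) unfolding coordmap_cyl[of h p n, OF assms(1), symmetric] by blast

lemma nowhere_dense_coordmap:
  assumes h: "\<And>i. surj (h i)" and A: "nowhere_dense A"
  shows "nowhere_dense (coordmap h -` A)"
  unfolding nowhere_dense_def
proof (intro allI)
  fix p n
  obtain q m where q: "q \<in> cyl (coordmap h p) n" "n \<le> m" "cyl q m \<inter> A = {}"
    using A unfolding nowhere_dense_def by meson
  obtain q' where q': "q' \<in> cyl p n" "coordmap h q' = q"
    using coordmap_cyl_lift[OF h q(1)] .
  have "coordmap h ` cyl q' m \<subseteq> cyl q m" using coordmap_cyl[of h, OF h] q'(2) by auto
  then show "\<exists>q m. q \<in> cyl p n \<and> n \<le> m \<and> cyl q m \<inter> coordmap h -` A = {}"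
    using q q' by blast
qed

lemma meager_coordmap:
  assumes h: "\<And>i. surj (h i)" and A: "meager A"
  shows "meager (coordmap h -` A)"
proof -
  obtain N where N: "\<And>i :: nat. nowhere_dense (N i)" "A \<subseteq> (\<Union>i. N i)"
    using A unfolding meager_def by blast
  have "nowhere_dense (coordmap h -` N i)" for i
    by (rule nowhere_dense_coordmap[OF h N(1)])
  moreover have "coordmap h -` A \<subseteq> (\<Union>i. coordmap h -` N i)"
    using vimage_mono[OF N(2), of "coordmap h"] by (simp only: vimage_UN)
  ultimately show ?thesis
    unfolding meager_def by (intro exI[of _ "\<lambda>i. coordmap h -` N i"] conjI allI)
qed

section \<open>Genericity as a filter\<close>

definition generic :: "(nat \<Rightarrow> 'a) set \<Rightarrow> (nat \<Rightarrow> 'a) filter" where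
  "generic C = Abs_filter (\<lambda>P. meager {p \<in> C. \<not> P p})"

text \<open>The filter form lets \<open>eventually_elim\<close> combine generic properties; that the
  filter is nontrivial on cylinders is \<open>generic_cyl_ex\<close>.\<close>

lemma eventually_generic: "eventually P (generic C) \<longleftrightarrow> meager {p \<in> C. \<not> P p}"
  unfolding generic_def
proof (rule eventually_Abs_filter, rule is_filter.intro)
  fix P Q
  assume "meager {p \<in> C. \<not> P p}" "meager {p \<in> C. \<not> Q p}"
  then show "meager {p \<in> C. \<not> (P p \<and> Q p)}"
    by (rule meager_mono[OF meager_Un]) auto
next
  fix P Q :: "(nat \<Rightarrow> 'a) \<Rightarrow> bool"
  assume "\<forall>x. P x \<longrightarrow> Q x" "meager {p \<in> C. \<not> P p}"
  then show "meager {p \<in> C. \<not> Q p}" by (auto elim: meager_mono)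
qed simp

lemma generic_in [simp]: "eventually (\<lambda>p. p \<in> C) (generic C)"
  by (simp add: eventually_generic)

lemma generic_subset: "eventually P (generic C) \<Longrightarrow> D \<subseteq> C \<Longrightarrow> eventually P (generic D)"
  unfolding eventually_generic by (rule meager_mono) auto

lemma generic_all_countable:
  fixes P :: "'c :: countable \<Rightarrow> _"
  assumes "\<And>i. i \<in> J \<Longrightarrow> eventually (P i) (generic C)"
  shows "eventually (\<lambda>p. \<forall>i\<in>J. P i p) (generic C)"
proof -
  have "meager (\<Union>i\<in>J. {p \<in> C. \<not> P i p})"
    using assms by (intro meager_UN) (simp add: eventually_generic)
  then show ?thesis unfolding eventually_generic by (rule meager_mono) auto
qed

lemma generic_cyl_ex:
  assumes "eventually P (generic (cyl p n))"
  obtains q where "q \<in> cyl p n" "P q"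
proof -
  have "meager {p' \<in> cyl p n. \<not> P p'}" using assms by (simp add: eventually_generic)
  then obtain q where "q \<in> cyl p n" "q \<notin> {p' \<in> cyl p n. \<not> P p'}" by (rule baire_cyl)
  then show ?thesis by (intro that[of q]) auto
qed

lemma generic_coordmap:
  assumes "\<And>i. surj (h i)" "eventually P (generic C)" "\<And>q. q \<in> D \<Longrightarrow> coordmap h q \<in> C"
  shows "eventually (\<lambda>q. P (coordmap h q)) (generic D)"
proof -
  have "meager (coordmap h -` {p \<in> C. \<not> P p})"
    using assms by (intro meager_coordmap) (auto simp: eventually_generic)
  then show ?thesis unfolding eventually_generic by (rule meager_mono) (use assms(3) in auto)
qed

section \<open>The Baire property\<close>

text \<open>A local form of the Baire property that is visibly preserved by complements and countable
  unions.\<close>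

definition baire_property :: "(nat \<Rightarrow> 'a) set \<Rightarrow> bool" where
  "baire_property A \<longleftrightarrow> (\<forall>p n. eventually (\<lambda>q. q \<notin> A) (generic (cyl p n)) \<or>
     (\<exists>q m. q \<in> cyl p n \<and> n \<le> m \<and> eventually (\<lambda>q. q \<in> A) (generic (cyl q m))))"

text \<open>Genericity on densely many subcylinders glues together: a countable alphabet has only
  countably many cylinders, and what the chosen ones leave uncovered is nowhere dense.\<close>

lemma cyl_cover:
  fixes P :: "(nat \<Rightarrow> 'a :: countable) \<Rightarrow> bool"
  assumes "\<And>q m. q \<in> cyl p n \<Longrightarrow> n \<le> m \<Longrightarrow>
     \<exists>q' m'. q' \<in> cyl q m \<and> m \<le> m' \<and> eventually P (generic (cyl q' m'))"
  shows "eventually P (generic (cyl p n))"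
proof -
  \<comment> \<open>Finite lists code the cylinders, so the union over \<open>T\<close> is
    countable.\<close>
  define T where "T = {s. \<exists>q m. s = map q [0..<m] \<and> eventually P (generic (cyl q m))}"
  define D where "D s = {q :: nat \<Rightarrow> 'a. map q [0..<length s] = s}" for s
  have D: "D (map q [0..<m]) = cyl q m" for q m
    by (auto simp: D_def cyl_def)
  have *: "meager (\<Union>s\<in>T. {q \<in> D s. \<not> P q})"
    by (rule meager_UN) (auto simp: T_def D eventually_generic)
  have "nowhere_dense (cyl p n - (\<Union>s\<in>T. D s))"
    unfolding nowhere_dense_def
  proof (intro allI)
    fix q m
    show "\<exists>q' m'. q' \<in> cyl q m \<and> m \<le> m' \<and> cyl q' m' \<inter> (cyl p n - (\<Union>s\<in>T. D s)) = {}"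
    proof (cases "\<exists>r. r \<in> cyl q m \<inter> cyl p n")
      case True
      then obtain r where r: "r \<in> cyl q m" "r \<in> cyl p n" by blast
      obtain q' m' where q': "q' \<in> cyl r (max m n)" "max m n \<le> m'" "eventually P (generic (cyl q' m'))"
        using assms[OF r(2), of "max m n"] by auto
      have "cyl q' m' \<subseteq> (\<Union>s\<in>T. D s)"
        using q'(3) D[of q' m'] unfolding T_def by blast
      moreover have "q' \<in> cyl q m" using q'(1) r cyl_mono[OF r(1), of "max m n"] by auto
      ultimately show ?thesis using q'(2) by (intro exI[of _ q'] exI[of _ m']) auto
    next
      case False
      then show ?thesis by (intro exI[of _ q] exI[of _ m]) auto
    qed
  qed
  then have "meager ((cyl p n - (\<Union>s\<in>T. D s)) \<union> (\<Union>s\<in>T. {q \<in> D s. \<not> P q}))"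
    by (intro meager_Un * nowhere_dense_imp_meager)
  then show ?thesis unfolding eventually_generic by (rule meager_mono) auto
qed

text \<open>If no subcylinder lies generically in the complement, then every subcylinder has a
  further one lying generically in \<open>A\<close>, and \<open>cyl_cover\<close> glues
  these.\<close>

lemma baire_property_Compl:
  fixes A :: "(nat \<Rightarrow> 'a :: countable) set"
  assumes "baire_property A"
  shows "baire_property (- A)"
  unfolding baire_property_def
proof (intro allI)
  fix p n
  show "eventually (\<lambda>q. q \<notin> - A) (generic (cyl p n)) \<or>
     (\<exists>q m. q \<in> cyl p n \<and> n \<le> m \<and> eventually (\<lambda>q. q \<in> - A) (generic (cyl q m)))"
  proof (rule disjCI)
    assume *: "\<not> (\<exists>q m. q \<in> cyl p n \<and> n \<le> m \<and> eventually (\<lambda>q. q \<in> - A) (generic (cyl q m)))"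
    show "eventually (\<lambda>q. q \<notin> - A) (generic (cyl p n))"
    proof (rule cyl_cover)
      fix q m assume "q \<in> cyl p n" "n \<le> m"
      then have "\<not> eventually (\<lambda>q. q \<notin> A) (generic (cyl q m))" using * by simp
      then show "\<exists>q' m'. q' \<in> cyl q m \<and> m \<le> m' \<and> eventually (\<lambda>q. q \<notin> - A) (generic (cyl q' m'))"
        using assms unfolding baire_property_def Compl_iff not_not by metis
    qed
  qed
qed

lemma baire_property_UN:
  assumes "\<And>i :: nat. baire_property (A i)"
  shows "baire_property (\<Union>i. A i)"
  unfolding baire_property_def
proof (intro allI)
  fix p n
  show "eventually (\<lambda>q. q \<notin> (\<Union>i. A i)) (generic (cyl p n)) \<or>
     (\<exists>q m. q \<in> cyl p n \<and> n \<le> m \<and> eventually (\<lambda>q. q \<in> (\<Union>i. A i)) (generic (cyl q m)))"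
  proof (cases "\<forall>i. eventually (\<lambda>q. q \<notin> A i) (generic (cyl p n))")
    case True
    then have "eventually (\<lambda>q. \<forall>i\<in>UNIV. q \<notin> A i) (generic (cyl p n))"
      by (intro generic_all_countable) simp
    then show ?thesis by simp
  next
    case False
    then obtain i q m where "q \<in> cyl p n" "n \<le> m" "eventually (\<lambda>q. q \<in> A i) (generic (cyl q m))"
      using assms unfolding baire_property_def by meson
    then show ?thesis by (metis (mono_tags, lifting) UNIV_I UN_I eventually_mono)
  qed
qed

lemma baire_property_open:
  assumes "\<And>p. p \<in> A \<Longrightarrow> \<exists>n. cyl p n \<subseteq> A"
  shows "baire_property A"
  unfolding baire_property_def
proof (intro allI)
  fix p n
  show "eventually (\<lambda>q. q \<notin> A) (generic (cyl p n)) \<or>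
     (\<exists>q m. q \<in> cyl p n \<and> n \<le> m \<and> eventually (\<lambda>q. q \<in> A) (generic (cyl q m)))"
  proof (cases "cyl p n \<inter> A = {}")
    case True
    then have "eventually (\<lambda>q. q \<notin> A) (generic (cyl p n))"
      by (auto intro: eventually_mono[OF generic_in])
    then show ?thesis ..
  next
    case False
    then obtain q m where q: "q \<in> cyl p n" "cyl q m \<subseteq> A" using assms by blast
    have "eventually (\<lambda>q. q \<in> A) (generic (cyl q (max m n)))"
      by (rule eventually_mono[OF generic_in]) (use q(2) cyl_mono[of q q m "max m n"] in auto)
    then show ?thesis using q(1) by (metis max.cobounded2)
  qed
qed

text \<open>Presents the sets with the Baire property as a measurable space, so that Baire
  measurable maps become elements of \<open>measurable\<close>.\<close>

definition bp_algebra :: "(nat \<Rightarrow> 'a :: countable) measure" where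
  "bp_algebra = sigma UNIV {A. baire_property A}"

lemma space_bp [simp]: "space bp_algebra = UNIV"
  by (simp add: bp_algebra_def)

lemma sets_bp: "sets bp_algebra = {A. baire_property A}"
proof -
  have "sigma_algebra UNIV {A :: (nat \<Rightarrow> 'a) set. baire_property A}"
    unfolding sigma_algebra_iff2
  proof (intro conjI ballI allI impI)
    show "{} \<in> {A :: (nat \<Rightarrow> 'a) set. baire_property A}"
      using baire_property_open[of "{}"] by simp
  next
    fix s :: "(nat \<Rightarrow> 'a) set" assume "s \<in> {A. baire_property A}"
    then show "UNIV - s \<in> {A. baire_property A}"
      using baire_property_Compl[of s] by (simp add: Compl_eq_Diff_UNIV[symmetric])
  next
    fix A :: "nat \<Rightarrow> (nat \<Rightarrow> 'a) set" assume "range A \<subseteq> {A. baire_property A}"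
    then show "(\<Union>i. A i) \<in> {A. baire_property A}"
      using baire_property_UN[of A] by auto
  qed simp
  then show ?thesis by (simp add: bp_algebra_def sigma_algebra.sigma_sets_eq)
qed

lemma measurable_coordmap:
  fixes h :: "nat \<Rightarrow> 'a :: countable \<Rightarrow> 'b :: countable"
  assumes h: "\<And>i. surj (h i)"
  shows "coordmap h \<in> measurable bp_algebra bp_algebra"
proof (rule measurableI)
  fix A :: "(nat \<Rightarrow> 'b) set" assume "A \<in> sets bp_algebra"
  then have A: "baire_property A" by (simp add: sets_bp)
  have "baire_property (coordmap h -` A)"
    unfolding baire_property_def
  proof (intro allI)
    fix p n
    have im: "coordmap h q \<in> cyl (coordmap h p) n" if "q \<in> cyl p n" for q p n
      using that by (auto simp: coordmap_def cyl_def)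
    consider "eventually (\<lambda>q. q \<notin> A) (generic (cyl (coordmap h p) n))"
      | q m where "q \<in> cyl (coordmap h p) n" "n \<le> m" "eventually (\<lambda>q. q \<in> A) (generic (cyl q m))"
      using A unfolding baire_property_def by meson
    then show "eventually (\<lambda>q. q \<notin> coordmap h -` A) (generic (cyl p n)) \<or>
       (\<exists>q m. q \<in> cyl p n \<and> n \<le> m \<and> eventually (\<lambda>q. q \<in> coordmap h -` A) (generic (cyl q m)))"
    proof cases
      case 1
      then show ?thesis using generic_coordmap[OF h 1 im] by simp
    next
      case 2
      obtain q' where q': "q' \<in> cyl p n" "coordmap h q' = q"
        using coordmap_cyl_lift[OF h 2(1)] .
      have "eventually (\<lambda>q. coordmap h q \<in> A) (generic (cyl q' m))"
        by (rule generic_coordmap[OF h 2(3)]) (use im q' in blast)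
      then show ?thesis using q' 2(2) by auto
    qed
  qed
  then show "coordmap h -` A \<inter> space bp_algebra \<in> sets bp_algebra" by (simp add: sets_bp)
qed simp

text \<open>A converse to \<open>generic_coordmap\<close> that stands in for the Kuratowski-Ulam
  theorem: if \<open>P\<close> were not generic, the Baire property would make it fail generically
  on some \<open>cyl x m\<close>, and a cylinder inside \<open>D\<close> mapped into it would
  contradict the Baire category theorem.\<close>

lemma generic_descend:
  fixes h :: "nat \<Rightarrow> 'a \<Rightarrow> 'b :: countable"
  assumes P: "{x. P x} \<in> sets bp_algebra" and h: "\<And>i. surj (h i)"
    and ev: "eventually (\<lambda>q. P (coordmap h q)) (generic D)"
    and D: "\<And>x m. x \<in> cyl x0 n \<Longrightarrow> n \<le> m \<Longrightarrow> \<exists>q k. cyl q k \<subseteq> D \<and> coordmap h ` cyl q k \<subseteq> cyl x m"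
  shows "eventually P (generic (cyl x0 n))"
proof (rule ccontr)
  assume "\<not> eventually P (generic (cyl x0 n))"
  then obtain x m where x: "x \<in> cyl x0 n" "n \<le> m" "eventually (\<lambda>q. \<not> P q) (generic (cyl x m))"
    using P baire_property_Compl[of "{x. P x}"]
    unfolding sets_bp baire_property_def mem_Collect_eq Compl_iff not_not by metis
  obtain q k where q: "cyl q k \<subseteq> D" "coordmap h ` cyl q k \<subseteq> cyl x m"
    using D[OF x(1,2)] by blast
  have "eventually (\<lambda>q. \<not> P (coordmap h q)) (generic (cyl q k))"
    by (rule generic_coordmap[OF h x(3)]) (use q in auto)
  moreover have "eventually (\<lambda>q. P (coordmap h q)) (generic (cyl q k))"
    by (rule generic_subset[OF ev q(1)])
  ultimately have "eventually (\<lambda>q. False) (generic (cyl q k))"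
    by eventually_elim simp
  then show False by (rule generic_cyl_ex)
qed

section \<open>Generic ergodicity\<close>

definition flip :: "(nat \<Rightarrow> bool) \<Rightarrow> nat set \<Rightarrow> nat \<Rightarrow> bool" where
  "flip x a = coordmap (\<lambda>i b. b \<noteq> (i \<in> a)) x"

text \<open>A sequence of pairs encodes a pair \<open>(x, g)\<close> of sets; \<open>base\<close> is \<open>x\<close> and \<open>act y\<close> is the
  symmetric difference of \<open>x\<close> and \<open>g \<inter> y\<close>. Thus \<open>g \<inter> y\<close> is a generic element of the compact
  group \<open>Pow y\<close>.\<close>

definition base :: "(nat \<Rightarrow> bool \<times> bool) \<Rightarrow> nat \<Rightarrow> bool" where
  "base = coordmap (\<lambda>_. fst)"

definition act :: "nat set \<Rightarrow> (nat \<Rightarrow> bool \<times> bool) \<Rightarrow> nat \<Rightarrow> bool" where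
  "act y = coordmap (\<lambda>i t. fst t \<noteq> (snd t \<and> i \<in> y))"

definition lift :: "(nat \<Rightarrow> bool) \<Rightarrow> nat \<Rightarrow> bool \<times> bool" where
  "lift x = (\<lambda>i. (x i, False))"

lemma flip_apply: "flip x a i \<longleftrightarrow> x i \<noteq> (i \<in> a)"
  by (simp add: flip_def coordmap_def)

lemma base_apply: "base p i \<longleftrightarrow> fst (p i)"
  by (simp add: base_def coordmap_def)

lemma act_apply: "act y p i \<longleftrightarrow> fst (p i) \<noteq> (snd (p i) \<and> i \<in> y)"
  by (simp add: act_def coordmap_def)

lemma surj_flip: "surj (\<lambda>b. b \<noteq> (i \<in> a))"
  by (rule surjI[of _ "\<lambda>b. b \<noteq> (i \<in> a)"]) auto

lemma surj_act: "surj (\<lambda>t. fst t \<noteq> (snd t \<and> i \<in> y))"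
  by (rule surjI[of _ "\<lambda>a. (a, False)"]) auto

lemma measurable_base [measurable]: "base \<in> measurable bp_algebra bp_algebra"
  unfolding base_def by (rule measurable_coordmap) simp

lemma measurable_act [measurable]: "act y \<in> measurable bp_algebra bp_algebra"
  unfolding act_def by (rule measurable_coordmap[OF surj_act])

lemma measurable_flip [measurable]: "(\<lambda>x. flip x a) \<in> measurable bp_algebra bp_algebra"
  unfolding flip_def using measurable_coordmap[OF surj_flip] by (simp add: eta_contract_eq)

definition bp_rel :: "((nat \<Rightarrow> bool) \<Rightarrow> (nat \<Rightarrow> bool) \<Rightarrow> bool) \<Rightarrow> bool" where
  "bp_rel R \<longleftrightarrow> {(x, y). R x y} \<in> sets (bp_algebra \<Otimes>\<^sub>M bp_algebra)"

text \<open>This is why \<open>bp_rel\<close> asks for membership in the product sigma-algebra: the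
  Baire property in the plane need not survive the substitution of Baire measurable maps for both
  arguments.\<close>

lemma bp_rel_sets:
  assumes "bp_rel R" "f \<in> measurable M bp_algebra" "g \<in> measurable M bp_algebra"
  shows "{p \<in> space M. R (f p) (g p)} \<in> sets M"
proof -
  have "(\<lambda>p. (f p, g p)) \<in> measurable M (bp_algebra \<Otimes>\<^sub>M bp_algebra)"
    using assms by simp
  from measurable_sets[OF this assms(1)[unfolded bp_rel_def]]
  have "(\<lambda>p. (f p, g p)) -` {(x, y). R x y} \<inter> space M \<in> sets M" .
  moreover have "(\<lambda>p. (f p, g p)) -` {(x, y). R x y} \<inter> space M = {p \<in> space M. R (f p) (g p)}"
    by auto
  ultimately show ?thesis by simp
qed

lemma bp_rel_sets':
  fixes f g :: "(nat \<Rightarrow> 'a :: countable) \<Rightarrow> _"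
  assumes "bp_rel R" "f \<in> measurable bp_algebra bp_algebra" "g \<in> measurable bp_algebra bp_algebra"
  shows "{p. R (f p) (g p)} \<in> sets bp_algebra"
  using bp_rel_sets[OF assms] by simp

text \<open>Generic invariance under \<open>Pow y\<close>, localised to a cylinder. Since
  \<open>lift\<close> has second component \<open>False\<close>, the generic \<open>g\<close>
  contains no number below \<open>n\<close>, and the action stays in the cylinder.\<close>

definition good :: "((nat \<Rightarrow> bool) \<Rightarrow> (nat \<Rightarrow> bool) \<Rightarrow> bool) \<Rightarrow> nat set \<Rightarrow> (nat \<Rightarrow> bool) \<Rightarrow> nat \<Rightarrow> bool" where
  "good E y x n \<longleftrightarrow> eventually (\<lambda>p. E (base p) (act y p)) (generic (cyl (lift x) n))"

text \<open>For generic \<open>(x, g, g')\<close> apply the hypothesis to \<open>(x, g)\<close> and to the pair obtained by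
  flipping both entries by \<open>g' \<inter> y\<close>; the target of the action is the same in both cases.\<close>

lemma good_from_common_target:
  assumes R: "eventually (\<lambda>p. R (base p) (act z p)) (generic (cyl p0 m))"
    and E: "bp_rel E" "\<And>a b c. R a c \<Longrightarrow> R b c \<Longrightarrow> E a b"
    and y: "y \<subseteq> z" "y \<subseteq> {m..}"
  shows "good E y (base p0) m"
proof -
  \<comment> \<open>A triple codes \<open>(x, g, g')\<close>. Here \<open>h1\<close> yields
    \<open>(x, g)\<close>, \<open>h2\<close> flips both of these by \<open>g'\<close> within
    \<open>y\<close>, and \<open>h3\<close> yields \<open>(x, g')\<close>.\<close>
  define h1 :: "nat \<Rightarrow> bool \<times> bool \<times> bool \<Rightarrow> bool \<times> bool" where "h1 = (\<lambda>_ t. (fst t, fst (snd t)))"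
  define h2 :: "nat \<Rightarrow> bool \<times> bool \<times> bool \<Rightarrow> bool \<times> bool"
    where "h2 = (\<lambda>i t. (fst t \<noteq> (snd (snd t) \<and> i \<in> y), fst (snd t) \<noteq> (snd (snd t) \<and> i \<in> y)))"
  define h3 :: "nat \<Rightarrow> bool \<times> bool \<times> bool \<Rightarrow> bool \<times> bool" where "h3 = (\<lambda>_ t. (fst t, snd (snd t)))"
  have surj: "surj (h1 i)" "surj (h2 i)" "surj (h3 i)" for i
    by (rule surjI[of _ "\<lambda>(a, b). (a, b, False)"] surjI[of _ "\<lambda>(a, c). (a, False, c)"];
        auto simp: h1_def h2_def h3_def)+
  define D where "D = {q. coordmap h1 q \<in> cyl p0 m}"
  have ev1: "eventually (\<lambda>q. R (base (coordmap h1 q)) (act z (coordmap h1 q))) (generic D)"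
    by (rule generic_coordmap[OF surj(1) R]) (simp add: D_def)
  have ev2: "eventually (\<lambda>q. R (base (coordmap h2 q)) (act z (coordmap h2 q))) (generic D)"
  proof (rule generic_coordmap[OF surj(2) R])
    fix q assume "q \<in> D"
    \<comment> \<open>As \<open>y\<close> has no element below \<open>m\<close>, the flips of
      \<open>h2\<close> leave the coordinates fixed by the cylinder alone.\<close>
    moreover have "i \<notin> y" if "i < m" for i using y(2) that by auto
    ultimately show "coordmap h2 q \<in> cyl p0 m"
      by (auto simp: D_def cyl_def coordmap_def h1_def h2_def)
  qed
  \<comment> \<open>The two flips cancel because \<open>y \<subseteq> z\<close>.\<close>
  have target: "act z (coordmap h1 q) = act z (coordmap h2 q)" for q
    using y(1) by (intro ext) (auto simp: act_apply coordmap_def h1_def h2_def)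
  have src: "base (coordmap h1 q) = base (coordmap h3 q)"
    "base (coordmap h2 q) = act y (coordmap h3 q)" for q
    by (intro ext, simp add: act_apply base_apply coordmap_def h1_def h2_def h3_def)+
  have ev3: "eventually (\<lambda>q. E (base (coordmap h3 q)) (act y (coordmap h3 q))) (generic D)"
    using ev1 ev2 by eventually_elim (use E(2) target src in metis)
  show ?thesis
    unfolding good_def
  proof (rule generic_descend[OF _ surj(3) ev3])
    show "{p. E (base p) (act y p)} \<in> sets bp_algebra"
      by (rule bp_rel_sets'[OF E(1)]) measurable
  next
    fix p k assume p: "p \<in> cyl (lift (base p0)) m" "m \<le> k"
    \<comment> \<open>\<open>x\<close> and \<open>g'\<close> come from \<open>p\<close>, so that
      \<open>h3\<close> returns \<open>p\<close>; \<open>g\<close> comes from \<open>p0\<close>, so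
      that \<open>h1\<close> lands in the cylinder of \<open>p0\<close>.\<close>
    define q where "q i = (fst (p i), snd (p0 i), snd (p i))" for i
    have "coordmap h1 r \<in> cyl p0 m" if "r \<in> cyl q k" for r
    proof -
      have "h1 i (r i) = p0 i" if "i < m" for i
      proof -
        have "r i = q i" "fst (p i) = fst (p0 i)"
          using \<open>r \<in> cyl q k\<close> p that by (auto simp: cyl_def lift_def base_apply)
        then show ?thesis by (simp add: h1_def q_def)
      qed
      then show ?thesis by (simp add: cyl_def coordmap_def)
    qed
    moreover have "coordmap h3 r \<in> cyl p k" if "r \<in> cyl q k" for r
      using that by (auto simp: cyl_def coordmap_def h3_def q_def)
    ultimately show "\<exists>q k'. cyl q k' \<subseteq> D \<and> coordmap h3 ` cyl q k' \<subseteq> cyl p k"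
      unfolding D_def by blast
  qed
qed

lemma base_lift [simp]: "base (lift x) = x"
  by (intro ext) (simp add: base_apply lift_def)

lemma good_subset:
  assumes "good E z x m" "bp_rel E" "equivp E" "y \<subseteq> z" "y \<subseteq> {m..}"
  shows "good E y x m"
  using good_from_common_target[OF assms(1)[unfolded good_def] assms(2) _ assms(4,5)] assms(3)
  by (metis base_lift equivp_symp equivp_transp)

text \<open>On the nonempty open set where \<open>j\<close> belongs to \<open>g\<close>, acting by
  \<open>{j}\<close> is the flip at \<open>j\<close>; there \<open>g\<close> can be projected
  away.\<close>

lemma good_singleton:
  assumes "good E {j} x0 n" "bp_rel E" "n \<le> j"
  shows "eventually (\<lambda>x. E x (flip x {j})) (generic (cyl x0 n))"
proof -
  define D where "D = cyl (lift x0) n \<inter> {p. snd (p j)}"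
  have "eventually (\<lambda>p. E (base p) (act {j} p)) (generic D)"
    using assms(1) unfolding good_def D_def by (rule generic_subset) auto
  then have "eventually (\<lambda>p. E (base p) (flip (base p) {j})) (generic D)"
    using generic_in[of D]
  proof eventually_elim
    case (elim p)
    have "act {j} p = flip (base p) {j}"
      using elim(2) by (intro ext) (auto simp: D_def act_apply flip_apply base_apply)
    then show ?case using elim(1) by simp
  qed
  then have ev: "eventually (\<lambda>p. E (coordmap (\<lambda>_. fst) p) (flip (coordmap (\<lambda>_. fst) p) {j})) (generic D)"
    by (simp add: base_def)
  show ?thesis
  proof (rule generic_descend[OF _ _ ev])
    show "{x. E x (flip x {j})} \<in> sets bp_algebra"
      by (rule bp_rel_sets'[OF assms(2)]) measurable
    show "surj fst" by simp
  next
    fix x m assume x: "x \<in> cyl x0 n" "n \<le> m"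
    \<comment> \<open>\<open>g\<close> is taken to be \<open>{j}\<close>, which agrees with
      \<open>lift x0\<close> below \<open>n\<close> since \<open>n \<le> j\<close>; a length of at
      least \<open>Suc j\<close> keeps \<open>j\<close> in \<open>g\<close> throughout the
      cylinder.\<close>
    define q where "q i = (x i, i = j)" for i
    have "cyl q (max m (Suc j)) \<subseteq> D"
    proof
      fix r assume "r \<in> cyl q (max m (Suc j))"
      then have r: "r i = q i" if "i < m \<or> i \<le> j" for i using that by (auto simp: cyl_def)
      then have "snd (r j)" by (simp add: q_def)
      moreover have "r i = lift x0 i" if "i < n" for i
        using r[of i] that x assms(3) by (auto simp: cyl_def q_def lift_def)
      ultimately show "r \<in> D" by (auto simp: D_def cyl_def)
    qed
    moreover have "coordmap (\<lambda>_. fst) ` cyl q (max m (Suc j)) \<subseteq> cyl x m"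
      by (auto simp: cyl_def coordmap_def q_def)
    ultimately show "\<exists>q k. cyl q k \<subseteq> D \<and> coordmap (\<lambda>_. fst) ` cyl q k \<subseteq> cyl x m" by blast
  qed
qed

lemma flip_in_cyl: "a \<subseteq> {n..} \<Longrightarrow> flip x a \<in> cyl x0 n \<longleftrightarrow> x \<in> cyl x0 n"
  by (force simp: cyl_def flip_apply)

lemma generic_flip:
  assumes "eventually P (generic C)" "\<And>x. x \<in> D \<Longrightarrow> flip x a \<in> C"
  shows "eventually (\<lambda>x. P (flip x a)) (generic D)"
  unfolding flip_def
  by (rule generic_coordmap[OF surj_flip assms(1)]) (use assms(2) in \<open>simp add: flip_def\<close>)

text \<open>Flips are composed one at a time: flipping by \<open>a\<close> maps the cylinder to
  itself and preserves genericity, so the next single flip may follow it.\<close>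

lemma generic_flip_finite:
  assumes "finite a" "equivp E"
    and "\<And>j. j \<in> a \<Longrightarrow> n \<le> j \<and> eventually (\<lambda>x. E x (flip x {j})) (generic (cyl x0 n))"
  shows "eventually (\<lambda>x. E x (flip x a)) (generic (cyl x0 n))"
  using assms(1,3)
proof (induction a)
  case empty
  have "flip x {} = x" for x by (intro ext) (simp add: flip_apply)
  then show ?case using equivp_reflp[OF assms(2)] by simp
next
  case (insert j a)
  have a: "a \<subseteq> {n..}" using insert.prems by auto
  have "eventually (\<lambda>x. E (flip x a) (flip (flip x a) {j})) (generic (cyl x0 n))"
    by (rule generic_flip[of "\<lambda>x. E x (flip x {j})"]) (use insert.prems a flip_in_cyl in auto)
  moreover have "eventually (\<lambda>x. E x (flip x a)) (generic (cyl x0 n))"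
    using insert by auto
  ultimately show ?case
  proof eventually_elim
    case (elim x)
    have "flip (flip x a) {j} = flip x (insert j a)"
      using insert.hyps by (intro ext) (auto simp: flip_apply)
    then show ?case using elim equivp_transp[OF assms(2)] by metis
  qed
qed

definition generically_const ::
    "((nat \<Rightarrow> bool) \<Rightarrow> (nat \<Rightarrow> bool) \<Rightarrow> bool) \<Rightarrow> (nat \<Rightarrow> bool) \<Rightarrow> nat \<Rightarrow> bool" where
  "generically_const E x n \<longleftrightarrow> (\<exists>c. eventually (\<lambda>x. E x c) (generic (cyl x n)))"

section \<open>Invariance under a tall P-ideal\<close>

locale tall_P_ideal =
  fixes I :: "nat set set"
  assumes P_ideal: "P_ideal I"
    and fin: "finite a \<Longrightarrow> a \<in> I"
    and tall: "infinite A \<Longrightarrow> \<exists>y\<subseteq>A. infinite y \<and> y \<in> I"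
begin

lemma subset_mem: "x \<in> I \<Longrightarrow> y \<subseteq> x \<Longrightarrow> y \<in> I"
  using P_ideal unfolding P_ideal_def set_ideal_def by blast

text \<open>If for each \<open>i\<close> some \<open>f i\<close> had no almost superset with
  \<open>Q i\<close>, the P-ideal property would give one \<open>z\<close> almost containing every
  \<open>f i\<close>, and no \<open>i\<close> would be left for \<open>z\<close>.\<close>

lemma cofinal_countable:
  fixes Q :: "'c :: countable \<Rightarrow> nat set \<Rightarrow> bool"
  assumes "\<And>y. y \<in> I \<Longrightarrow> \<exists>i. Q i y"
  obtains i where "\<And>y. y \<in> I \<Longrightarrow> \<exists>z\<in>I. finite (y - z) \<and> Q i z"
proof (rule ccontr)
  assume "\<not> thesis"
  then have "\<forall>i. \<exists>y\<in>I. \<forall>z\<in>I. finite (y - z) \<longrightarrow> \<not> Q i z" using that by blast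
  then obtain f where f: "\<And>i. f i \<in> I" "\<And>i z. z \<in> I \<Longrightarrow> finite (f i - z) \<Longrightarrow> \<not> Q i z" by metis
  have "range (\<lambda>n. f (from_nat n)) \<subseteq> I" using f(1) by auto
  then obtain z where z: "z \<in> I" "\<And>n :: nat. finite (f (from_nat n) - z)"
    using P_ideal unfolding P_ideal_def by meson
  obtain i where "Q i z" using assms z(1) by blast
  then show False using f(2)[OF z(1), of i] z(2)[of "to_nat i"] by simp
qed

definition inv_rel :: "((nat \<Rightarrow> bool) \<Rightarrow> (nat \<Rightarrow> bool) \<Rightarrow> bool) \<Rightarrow> (nat \<Rightarrow> bool) \<Rightarrow> nat \<Rightarrow> bool" where
  "inv_rel E x n \<longleftrightarrow> (\<forall>y\<in>I. y \<subseteq> {n..} \<longrightarrow> good E y x n)"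

lemma inv_rel_finite:
  assumes "inv_rel E x0 n" "bp_rel E" "equivp E" "finite a" "a \<subseteq> {n..}"
  shows "eventually (\<lambda>x. E x (flip x a)) (generic (cyl x0 n))"
proof (rule generic_flip_finite[OF assms(4,3)])
  fix j assume "j \<in> a"
  then have j: "n \<le> j" using assms(5) by auto
  then have "good E {j} x0 n" using assms(1) fin[of "{j}"] unfolding inv_rel_def by auto
  then show "n \<le> j \<and> eventually (\<lambda>x. E x (flip x {j})) (generic (cyl x0 n))"
    using good_singleton[OF _ assms(2) j] j by blast
qed

text \<open>A point of the large cylinder enters the small one by a change in finitely many
  coordinates. Only finitely many such changes occur, and by invariance each generically keeps the
  \<open>E\<close>-class.\<close>

lemma inv_rel_spread:
  assumes "inv_rel E x0 n" "bp_rel E" "equivp E" "x1 \<in> cyl x0 n" "n \<le> m"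
    and P: "eventually P (generic (cyl x1 m))"
  shows "eventually (\<lambda>x. \<exists>x'. E x x' \<and> P x') (generic (cyl x0 n))"
proof -
  have "eventually (\<lambda>x. \<forall>a\<in>Pow {n..<m}. E x (flip x a) \<and> (flip x a \<in> cyl x1 m \<longrightarrow> P (flip x a)))
      (generic (cyl x0 n))"
  proof (intro eventually_ball_finite ballI eventually_conj)
    fix a assume a: "a \<in> Pow {n..<m}"
    then show "eventually (\<lambda>x. E x (flip x a)) (generic (cyl x0 n))"
      using finite_subset[of a "{n..<m}"] by (intro inv_rel_finite[OF assms(1-3)]) auto
    have "eventually (\<lambda>x. P (flip x a)) (generic {x. flip x a \<in> cyl x1 m})"
      by (rule generic_flip[OF P]) simp
    then show "eventually (\<lambda>x. flip x a \<in> cyl x1 m \<longrightarrow> P (flip x a)) (generic (cyl x0 n))"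
      unfolding eventually_generic by (rule meager_mono) auto
  qed simp
  then show ?thesis using generic_in[of "cyl x0 n"]
  proof eventually_elim
    case (elim x)
    define a where "a = {i \<in> {n..<m}. x i \<noteq> x1 i}"
    have "a \<in> Pow {n..<m}" by (auto simp: a_def)
    moreover have "flip x a \<in> cyl x1 m"
      using elim(2) assms(4) by (force simp: a_def cyl_def flip_apply)
    ultimately show ?case using elim(1) by blast
  qed
qed

lemma generically_const_spread:
  assumes "inv_rel E x0 n" "bp_rel E" "equivp E" "x1 \<in> cyl x0 n" "n \<le> m"
    and "generically_const E x1 m"
  shows "generically_const E x0 n"
proof -
  obtain c where "eventually (\<lambda>x. E x c) (generic (cyl x1 m))"
    using assms(6) unfolding generically_const_def by blast
  from inv_rel_spread[OF assms(1-5) this]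
  have "eventually (\<lambda>x. E x c) (generic (cyl x0 n))"
    by (rule eventually_mono) (use equivp_transp[OF assms(3)] in blast)
  then show ?thesis unfolding generically_const_def by blast
qed

text \<open>The passage from \<open>m\<close> to \<open>m'\<close> is where tallness enters: all but finitely many singletons, and
  hence all finite subsets of \<open>{m'..}\<close>, preserve \<open>E\<close> generically.\<close>

lemma inv_rel_of_cofinal:
  assumes E: "bp_rel E" "equivp E"
    and cof: "\<And>y. y \<in> I \<Longrightarrow> \<exists>z\<in>I. finite (y - z) \<and> good E (z \<inter> {m..}) x m"
  obtains m' where "m \<le> m'" "inv_rel E x m'"
proof -
  \<comment> \<open>\<open>B\<close> collects the singletons that fail to act invariantly. Were it
    infinite, tallness would give an infinite \<open>y\<close> in \<open>I\<close> inside it, and a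
    good \<open>z\<close> almost containing \<open>y\<close> would meet it.\<close>
  define B where "B = {j \<in> {m..}. \<not> eventually (\<lambda>x. E x (flip x {j})) (generic (cyl x m))}"
  have "finite B"
  proof (rule ccontr)
    assume "infinite B"
    then obtain y where y: "y \<subseteq> B" "infinite y" "y \<in> I" using tall by blast
    obtain z where z: "z \<in> I" "finite (y - z)" "good E (z \<inter> {m..}) x m" using cof[OF y(3)] by blast
    have "infinite (y \<inter> z)" using y(2) z(2) by (metis Diff_Diff_Int infinite_super Diff_infinite_finite Int_lower1)
    then obtain j where j: "j \<in> y" "j \<in> z" by (metis IntE finite.emptyI ex_in_conv)
    then have jm: "m \<le> j" using y(1) by (auto simp: B_def)
    have "good E {j} x m" by (rule good_subset[OF z(3) E]) (use j jm in auto)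
    then have "eventually (\<lambda>x. E x (flip x {j})) (generic (cyl x m))"
      using good_singleton E(1) jm by blast
    then show False using j y(1) by (auto simp: B_def)
  qed
  then obtain m' where m': "\<And>j. j \<in> B \<Longrightarrow> j < m'" "m \<le> m'"
    by (metis finite_nat_set_iff_bounded max.cobounded1 max.strict_coboundedI2)
  have sub: "cyl x m' \<subseteq> cyl x m" by (rule cyl_mono) (use m' in auto)
  have fins: "eventually (\<lambda>x. E x (flip x a)) (generic (cyl x m'))" if "finite a" "a \<subseteq> {m'..}" for a
  proof (rule generic_flip_finite[OF that(1) E(2)])
    fix j assume "j \<in> a"
    then have "m' \<le> j" using that(2) by auto
    then have "j \<notin> B" "j \<in> {m..}" using m' by (force, simp)
    then have "eventually (\<lambda>x. E x (flip x {j})) (generic (cyl x m))" by (auto simp: B_def)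
    then show "m' \<le> j \<and> eventually (\<lambda>x. E x (flip x {j})) (generic (cyl x m'))"
      using \<open>m' \<le> j\<close> sub generic_subset by blast
  qed
  have "good E y x m'" if y: "y \<in> I" "y \<subseteq> {m'..}" for y
  proof -
    obtain z where z: "z \<in> I" "finite (y - z)" "good E (z \<inter> {m..}) x m" using cof[OF y(1)] by blast
    have "good E (y \<inter> z) x m" by (rule good_subset[OF z(3) E]) (use y m' in auto)
    moreover have "cyl (lift x) m' \<subseteq> cyl (lift x) m" by (rule cyl_mono) (use m' in auto)
    ultimately have "eventually (\<lambda>p. E (base p) (act (y \<inter> z) p)) (generic (cyl (lift x) m'))"
      unfolding good_def using generic_subset by blast
    \<comment> \<open>The part of the finite set \<open>y - z\<close> that gets flipped depends on
      \<open>p\<close>, so all its subsets are treated at once.\<close>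
    moreover have "eventually (\<lambda>p. \<forall>a\<in>Pow (y - z). E (act (y \<inter> z) p) (flip (act (y \<inter> z) p) a))
        (generic (cyl (lift x) m'))"
    proof (rule eventually_ball_finite)
      show "\<forall>a\<in>Pow (y - z). eventually (\<lambda>p. E (act (y \<inter> z) p) (flip (act (y \<inter> z) p) a))
          (generic (cyl (lift x) m'))"
      proof
        fix a assume a: "a \<in> Pow (y - z)"
        have ev: "eventually (\<lambda>x. E x (flip x a)) (generic (cyl x m'))"
          using a z(2) y(2) by (intro fins) (auto intro: finite_subset)
        have "i \<notin> y" if "i < m'" for i using y(2) that by auto
        then have "act (y \<inter> z) p \<in> cyl x m'" if "p \<in> cyl (lift x) m'" for p
          using that by (auto simp: cyl_def act_apply lift_def)
        then show "eventually (\<lambda>p. E (act (y \<inter> z) p) (flip (act (y \<inter> z) p) a))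
          (generic (cyl (lift x) m'))"
          unfolding act_def by (intro generic_coordmap[OF surj_act ev]) simp
      qed
    qed (use z(2) in simp)
    ultimately show ?thesis
      unfolding good_def
    proof eventually_elim
      case (elim p)
      define a where "a = {i \<in> y - z. snd (p i)}"
      have "flip (act (y \<inter> z) p) a = act y p"
        by (intro ext) (auto simp: a_def flip_apply act_apply)
      moreover have "a \<in> Pow (y - z)" by (auto simp: a_def)
      ultimately show ?case using elim equivp_transp[OF E(2)] by metis
    qed
  qed
  then show ?thesis using m'(2) that unfolding inv_rel_def by blast
qed

text \<open>For each \<open>y\<close> the Baire property gives an \<open>l\<close> with
  \<open>R l\<close> generic on some cylinder, and \<open>good_from_common_target\<close> turns this
  into invariance for \<open>E l\<close>. Pairs of an \<open>l\<close> and a cylinder are countable,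
  so one pair serves cofinally many \<open>y\<close>, and after shrinking the cylinder all of them.
  Keeping \<open>R\<close> apart from \<open>E\<close> admits \<open>R l\<close> that are not
  equivalences, as the countable power requires.\<close>

lemma inv_rel_localize:
  fixes R E :: "'c :: countable \<Rightarrow> (nat \<Rightarrow> bool) \<Rightarrow> (nat \<Rightarrow> bool) \<Rightarrow> bool"
  assumes R: "\<And>l. bp_rel (R l)" "\<And>l a b c. R l a c \<Longrightarrow> R l b c \<Longrightarrow> E l a b"
    and E: "\<And>l. bp_rel (E l)" "\<And>l. equivp (E l)"
    and inv: "\<And>y. y \<in> I \<Longrightarrow> y \<subseteq> {n..} \<Longrightarrow> good (\<lambda>a b. \<exists>l. R l a b) y x0 n"
    and x1: "x1 \<in> cyl x0 n" "n \<le> n1"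
  obtains l x2 m where "x2 \<in> cyl x1 n1" "n1 \<le> m" "inv_rel (E l) x2 m"
proof -
  \<comment> \<open>Padding a finite sequence with \<open>False\<close> gives a canonical centre of
    its cylinder, so that the index of \<open>Q\<close> ranges over a countable type.\<close>
  define ext where "ext s = (\<lambda>i. i < length s \<and> s ! i)" for s :: "bool list"
  define Q where "Q = (\<lambda>(l, s) y. n1 \<le> length s \<and> ext s \<in> cyl x1 n1 \<and>
    good (E l) (y \<inter> {length s..}) (ext s) (length s))"
  have "\<exists>i. Q i y" if y: "y \<in> I" for y
  proof -
    define z where "z = y \<inter> {n..}"
    have "cyl (lift x1) n1 \<subseteq> cyl (lift x0) n"
      using x1 by (auto simp: cyl_def lift_def)
    then have ev: "eventually (\<lambda>p. \<exists>l. R l (base p) (act z p)) (generic (cyl (lift x1) n1))"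
      using inv[of z] subset_mem[OF y, of z] generic_subset unfolding good_def by (auto simp: z_def)
    have "\<exists>l. \<not> eventually (\<lambda>p. \<not> R l (base p) (act z p)) (generic (cyl (lift x1) n1))"
    proof (rule ccontr)
      assume "\<not> ?thesis"
      then have "eventually (\<lambda>p. \<forall>l\<in>UNIV. \<not> R l (base p) (act z p)) (generic (cyl (lift x1) n1))"
        by (intro generic_all_countable) blast
      with ev have "eventually (\<lambda>p. False) (generic (cyl (lift x1) n1))"
        by eventually_elim blast
      then show False by (rule generic_cyl_ex)
    qed
    then obtain l where l: "\<not> eventually (\<lambda>p. p \<notin> {p. R l (base p) (act z p)}) (generic (cyl (lift x1) n1))"
      by auto
    have "{p. R l (base p) (act z p)} \<in> sets bp_algebra"
      by (rule bp_rel_sets'[OF R(1)]) measurable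
    then have "baire_property {p. R l (base p) (act z p)}" by (simp add: sets_bp)
    with l obtain p m where p: "p \<in> cyl (lift x1) n1" "n1 \<le> m"
      "eventually (\<lambda>p. p \<in> {p. R l (base p) (act z p)}) (generic (cyl p m))"
      unfolding baire_property_def by blast
    have g: "good (E l) (y \<inter> {m..}) (base p) m"
      by (rule good_from_common_target[OF _ E(1)[of l], of "R l" z])
        (use p x1 R(2) in \<open>auto simp: z_def\<close>)
    define s where "s = map (base p) [0..<m]"
    have s: "length s = m" "ext s i = base p i" if "i < m" for i
      using that by (auto simp: s_def ext_def)
    have len: "length s = m" by (simp add: s_def)
    \<comment> \<open>\<open>good\<close> sees only the first \<open>m\<close> coordinates of its
      centre, so \<open>ext s\<close> may replace \<open>base p\<close>.\<close>
    have "cyl (lift (ext s)) m = cyl (lift (base p)) m"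
      by (rule cyl_eq) (use s(2) in \<open>simp add: cyl_def lift_def\<close>)
    then have "good (E l) (y \<inter> {m..}) (ext s) m"
      using g by (simp add: good_def)
    moreover have "ext s \<in> cyl x1 n1"
      using p(1,2) s(2) by (auto simp: cyl_def lift_def base_apply)
    ultimately have "Q (l, s) y" using p(2) by (simp add: Q_def len)
    then show ?thesis ..
  qed
  then obtain i where i: "\<And>y. y \<in> I \<Longrightarrow> \<exists>z\<in>I. finite (y - z) \<and> Q i z"
    using cofinal_countable[of Q] by blast
  obtain l s where ls: "i = (l, s)" by (cases i)
  obtain m' where m': "length s \<le> m'" "inv_rel (E l) (ext s) m'"
    by (rule inv_rel_of_cofinal[OF E(1)[of l] E(2)[of l], of "length s" "ext s"]) (use i in \<open>auto simp: Q_def ls\<close>)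
  have "n1 \<le> length s" "ext s \<in> cyl x1 n1"
    using i[OF fin[of "{}"]] by (auto simp: Q_def ls)
  then show ?thesis using m' by (intro that[of "ext s" m' l]) auto
qed

section \<open>Generic ergodicity and its closure properties\<close>

definition ergodic :: "'y measure \<Rightarrow> ('y \<times> 'y) set \<Rightarrow> bool" where
  "ergodic M F \<longleftrightarrow> equiv (space M) F \<and> F \<in> sets (M \<Otimes>\<^sub>M M) \<and>
     (\<forall>\<theta>\<in>measurable bp_algebra M. \<forall>x n.
        inv_rel (\<lambda>a b. (\<theta> a, \<theta> b) \<in> F) x n \<longrightarrow> generically_const (\<lambda>a b. (\<theta> a, \<theta> b) \<in> F) x n)"

lemma bp_rel_vimage:
  assumes "\<theta> \<in> measurable bp_algebra M" "\<eta> \<in> measurable bp_algebra M" "F \<in> sets (M \<Otimes>\<^sub>M M)"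
  shows "bp_rel (\<lambda>a b. (\<theta> a, \<eta> b) \<in> F)"
proof -
  have "(\<lambda>z. (\<theta> (fst z), \<eta> (snd z))) \<in> measurable (bp_algebra \<Otimes>\<^sub>M bp_algebra) (M \<Otimes>\<^sub>M M)"
    using assms(1,2) by measurable
  from measurable_sets[OF this assms(3)]
  have "(\<lambda>z. (\<theta> (fst z), \<eta> (snd z))) -` F \<inter> space (bp_algebra \<Otimes>\<^sub>M bp_algebra) \<in>
    sets (bp_algebra \<Otimes>\<^sub>M bp_algebra)" .
  also have "(\<lambda>z. (\<theta> (fst z), \<eta> (snd z))) -` F \<inter> space (bp_algebra \<Otimes>\<^sub>M bp_algebra) =
    {(x, y). (\<theta> x, \<eta> y) \<in> F}"
    by (auto simp: space_pair_measure)
  finally show ?thesis by (simp add: bp_rel_def)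
qed

lemma equivp_vimage:
  assumes "\<theta> \<in> measurable bp_algebra M" "equiv (space M) F"
  shows "equivp (\<lambda>a b. (\<theta> a, \<theta> b) \<in> F)"
proof (rule equivpI)
  have "\<theta> a \<in> space M" for a using measurable_space[OF assms(1)] by simp
  then show "reflp (\<lambda>a b. (\<theta> a, \<theta> b) \<in> F)"
    using assms(2) by (auto simp: reflp_def equiv_def refl_on_def)
  show "symp (\<lambda>a b. (\<theta> a, \<theta> b) \<in> F)"
    using assms(2) by (auto simp: symp_def equiv_def sym_def)
  show "transp (\<lambda>a b. (\<theta> a, \<theta> b) \<in> F)"
    using assms(2) by (auto simp: equiv_def intro!: transpI dest: transD)
qed

lemma inv_rel_mono:
  assumes "inv_rel E x n" "\<And>a b. E a b \<Longrightarrow> E' a b"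
  shows "inv_rel E' x n"
  unfolding inv_rel_def good_def
proof (intro ballI impI)
  fix y assume "y \<in> I" "y \<subseteq> {n..}"
  then have "eventually (\<lambda>p. E (base p) (act y p)) (generic (cyl (lift x) n))"
    using assms(1) by (simp add: inv_rel_def good_def)
  then show "eventually (\<lambda>p. E' (base p) (act y p)) (generic (cyl (lift x) n))"
    by (rule eventually_mono) (rule assms(2))
qed

text \<open>\<open>ergodic\<close> speaks of all Baire measurable maps and all cylinders; this lets
  the closure proofs pass to coordinate maps and to subcylinders.\<close>

lemma ergodicI:
  assumes "equiv (space M) F" "F \<in> sets (M \<Otimes>\<^sub>M M)"
    and "\<And>\<theta> x n. \<lbrakk>\<theta> \<in> measurable bp_algebra M; inv_rel (\<lambda>a b. (\<theta> a, \<theta> b) \<in> F) x n;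
        bp_rel (\<lambda>a b. (\<theta> a, \<theta> b) \<in> F); equivp (\<lambda>a b. (\<theta> a, \<theta> b) \<in> F)\<rbrakk>
      \<Longrightarrow> generically_const (\<lambda>a b. (\<theta> a, \<theta> b) \<in> F) x n"
  shows "ergodic M F"
  unfolding ergodic_def
proof (intro conjI ballI allI impI)
  fix \<theta> x n
  assume *: "\<theta> \<in> measurable bp_algebra M" "inv_rel (\<lambda>a b. (\<theta> a, \<theta> b) \<in> F) x n"
  show "generically_const (\<lambda>a b. (\<theta> a, \<theta> b) \<in> F) x n"
    by (rule assms(3)[OF * bp_rel_vimage[OF *(1) *(1) assms(2)] equivp_vimage[OF *(1) assms(1)]])
qed (fact assms)+

lemma ergodicD:
  assumes "ergodic M F"
  shows "equiv (space M) F" "F \<in> sets (M \<Otimes>\<^sub>M M)"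
    "\<theta> \<in> measurable bp_algebra M \<Longrightarrow> inv_rel (\<lambda>a b. (\<theta> a, \<theta> b) \<in> F) x n \<Longrightarrow>
      generically_const (\<lambda>a b. (\<theta> a, \<theta> b) \<in> F) x n"
    "\<theta> \<in> measurable bp_algebra M \<Longrightarrow> equivp (\<lambda>a b. (\<theta> a, \<theta> b) \<in> F)"
    "\<theta> \<in> measurable bp_algebra M \<Longrightarrow> \<eta> \<in> measurable bp_algebra M \<Longrightarrow> bp_rel (\<lambda>a b. (\<theta> a, \<eta> b) \<in> F)"
proof -
  show eq: "equiv (space M) F" and F: "F \<in> sets (M \<Otimes>\<^sub>M M)"
    using assms by (simp_all add: ergodic_def)
  show "\<theta> \<in> measurable bp_algebra M \<Longrightarrow> inv_rel (\<lambda>a b. (\<theta> a, \<theta> b) \<in> F) x n \<Longrightarrow>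
      generically_const (\<lambda>a b. (\<theta> a, \<theta> b) \<in> F) x n"
    using assms by (simp add: ergodic_def)
  show "\<theta> \<in> measurable bp_algebra M \<Longrightarrow> equivp (\<lambda>a b. (\<theta> a, \<theta> b) \<in> F)"
    by (rule equivp_vimage[OF _ eq])
  show "\<theta> \<in> measurable bp_algebra M \<Longrightarrow> \<eta> \<in> measurable bp_algebra M \<Longrightarrow> bp_rel (\<lambda>a b. (\<theta> a, \<eta> b) \<in> F)"
    by (rule bp_rel_vimage[OF _ _ F])
qed

text \<open>The preimage of \<open>B\<close> has the Baire property: either it is generically
  avoided, or it is generic in a subcylinder, from where constancy spreads by invariance.\<close>

lemma ergodic_two_classes:
  assumes B: "B \<in> sets M"
  shows "ergodic M {(x, y). x \<in> space M \<and> y \<in> space M \<and> (x \<in> B \<longleftrightarrow> y \<in> B)}" (is "ergodic M ?F")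
proof (rule ergodicI)
  show "equiv (space M) ?F"
    by (rule equivI) (auto simp: refl_on_def sym_def trans_def)
  have "?F = B \<times> B \<union> (space M - B) \<times> (space M - B)"
    using sets.sets_into_space[OF B] by auto
  then show "?F \<in> sets (M \<Otimes>\<^sub>M M)" using B by auto
next
  fix \<theta> x n
  assume \<theta>: "\<theta> \<in> measurable bp_algebra M" and inv: "inv_rel (\<lambda>a b. (\<theta> a, \<theta> b) \<in> ?F) x n"
    "bp_rel (\<lambda>a b. (\<theta> a, \<theta> b) \<in> ?F)" "equivp (\<lambda>a b. (\<theta> a, \<theta> b) \<in> ?F)"
  have sp: "\<theta> a \<in> space M" for a using measurable_space[OF \<theta>] by simp
  define A where "A = \<theta> -` B"
  have const: "generically_const (\<lambda>a b. (\<theta> a, \<theta> b) \<in> ?F) p m"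
    if ev: "eventually (\<lambda>a. (\<theta> a \<in> B) = t) (generic (cyl p m))" for p m t
  proof -
    obtain c where c: "(\<theta> c \<in> B) = t" using generic_cyl_ex[OF ev] .
    show ?thesis
      unfolding generically_const_def by (rule exI[of _ c], rule eventually_mono[OF ev]) (use c sp in auto)
  qed
  have "baire_property A"
    using measurable_sets[OF \<theta> B] by (simp add: sets_bp A_def)
  then consider "eventually (\<lambda>a. a \<notin> A) (generic (cyl x n))"
    | p m where "p \<in> cyl x n" "n \<le> m" "eventually (\<lambda>a. a \<in> A) (generic (cyl p m))"
    unfolding baire_property_def by meson
  then show "generically_const (\<lambda>a b. (\<theta> a, \<theta> b) \<in> ?F) x n"
  proof cases
    case 1
    then show ?thesis using const[of False] by (simp add: A_def)
  next
    case 2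
    then have "generically_const (\<lambda>a b. (\<theta> a, \<theta> b) \<in> ?F) p m"
      using const[of True] by (simp add: A_def)
    then show ?thesis by (rule generically_const_spread[OF inv 2(1,2)])
  qed
qed

lemma ergodic_vimage:
  assumes f: "f \<in> measurable M N" and F: "ergodic N F"
  shows "ergodic M {(x, y). x \<in> space M \<and> y \<in> space M \<and> (f x, f y) \<in> F}" (is "ergodic M ?F")
proof (rule ergodicI)
  have "f x \<in> space N" if "x \<in> space M" for x using measurable_space[OF f that] .
  moreover have F': "refl_on (space N) F" "sym F" "trans F"
    using ergodicD(1)[OF F] by (auto simp: equiv_def)
  ultimately show "equiv (space M) ?F"
    by (intro equivI) (auto simp: refl_on_def intro!: symI transI dest: symD transD)
  have "(\<lambda>z. (f (fst z), f (snd z))) \<in> measurable (M \<Otimes>\<^sub>M M) (N \<Otimes>\<^sub>M N)"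
    using f by measurable
  from measurable_sets[OF this ergodicD(2)[OF F]]
  have "(\<lambda>z. (f (fst z), f (snd z))) -` F \<inter> space (M \<Otimes>\<^sub>M M) \<in> sets (M \<Otimes>\<^sub>M M)" .
  also have "(\<lambda>z. (f (fst z), f (snd z))) -` F \<inter> space (M \<Otimes>\<^sub>M M) = ?F"
    by (auto simp: space_pair_measure)
  finally show "?F \<in> sets (M \<Otimes>\<^sub>M M)" .
next
  fix \<theta> x n assume \<theta>: "\<theta> \<in> measurable bp_algebra M" and inv: "inv_rel (\<lambda>a b. (\<theta> a, \<theta> b) \<in> ?F) x n"
  have sp: "\<theta> a \<in> space M" for a using measurable_space[OF \<theta>] by simp
  have "(\<lambda>a. f (\<theta> a)) \<in> measurable bp_algebra N" using f \<theta> by simp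
  from ergodicD(3)[OF F this] show "generically_const (\<lambda>a b. (\<theta> a, \<theta> b) \<in> ?F) x n"
    using inv sp by simp
qed

lemma ergodic_INT:
  fixes F :: "'c :: countable \<Rightarrow> _"
  assumes F: "\<And>k. ergodic M (F k)"
  shows "ergodic M (\<Inter>k. F k)"
proof (rule ergodicI)
  show "equiv (space M) (\<Inter>k. F k)"
  proof (rule equivI)
    have F': "refl_on (space M) (F k)" "sym (F k)" "trans (F k)" "F k \<subseteq> space M \<times> space M" for k
      using ergodicD(1)[OF F[of k]] by (auto simp: equiv_def)
    show "(\<Inter>k. F k) \<subseteq> space M \<times> space M" using F'(4) by blast
    show "refl_on (space M) (\<Inter>k. F k)" using F'(1) by (auto simp: refl_on_def)
    show "sym (\<Inter>k. F k)" using F'(2) by (auto simp: sym_def)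
    show "trans (\<Inter>k. F k)" using F'(3) by (meson trans_INTER)
  qed
  show "(\<Inter>k. F k) \<in> sets (M \<Otimes>\<^sub>M M)"
    using ergodicD(2)[OF F] by (intro sets.countable_INT') auto
next
  fix \<theta> x n assume \<theta>: "\<theta> \<in> measurable bp_algebra M" and inv: "inv_rel (\<lambda>a b. (\<theta> a, \<theta> b) \<in> (\<Inter>k. F k)) x n"
  have "\<exists>c. eventually (\<lambda>a. (\<theta> a, \<theta> c) \<in> F k) (generic (cyl x n))" for k
    using ergodicD(3)[OF F \<theta> inv_rel_mono[OF inv], of k] unfolding generically_const_def by auto
  then obtain c where "\<And>k. eventually (\<lambda>a. (\<theta> a, \<theta> (c k)) \<in> F k) (generic (cyl x n))" by metis
  then have ev: "eventually (\<lambda>a. \<forall>k\<in>UNIV. (\<theta> a, \<theta> (c k)) \<in> F k) (generic (cyl x n))"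
    by (rule generic_all_countable)
  \<comment> \<open>The constants \<open>c k\<close> vary with \<open>k\<close>; one point
    \<open>d\<close> satisfying all the relations serves as a common constant.\<close>
  obtain d where d: "\<forall>k\<in>UNIV. (\<theta> d, \<theta> (c k)) \<in> F k" using generic_cyl_ex[OF ev] .
  from ev have "eventually (\<lambda>a. (\<theta> a, \<theta> d) \<in> (\<Inter>k. F k)) (generic (cyl x n))"
  proof eventually_elim
    case (elim a)
    have "(\<theta> a, \<theta> d) \<in> F k" for k
      using equivp_transp[OF ergodicD(4)[OF F \<theta>]] equivp_symp[OF ergodicD(4)[OF F \<theta>]] elim d by blast
    then show ?case by blast
  qed
  then show "generically_const (\<lambda>a b. (\<theta> a, \<theta> b) \<in> (\<Inter>k. F k)) x n"
    unfolding generically_const_def by blast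
qed

text \<open>On a subcylinder a single \<open>F k\<close> is already invariant; its constancy passes
  to the union, whose own invariance spreads it back.\<close>

lemma ergodic_UN:
  fixes F :: "'c :: countable \<Rightarrow> _"
  assumes F: "\<And>k. ergodic M (F k)" and eq: "equiv (space M) (\<Union>k. F k)"
  shows "ergodic M (\<Union>k. F k)"
proof (rule ergodicI[OF eq])
  show "(\<Union>k. F k) \<in> sets (M \<Otimes>\<^sub>M M)"
    using ergodicD(2)[OF F] by (intro sets.countable_UN'') auto
next
  fix \<theta> x n
  assume \<theta>: "\<theta> \<in> measurable bp_algebra M" and inv: "inv_rel (\<lambda>a b. (\<theta> a, \<theta> b) \<in> (\<Union>k. F k)) x n"
    "bp_rel (\<lambda>a b. (\<theta> a, \<theta> b) \<in> (\<Union>k. F k))" "equivp (\<lambda>a b. (\<theta> a, \<theta> b) \<in> (\<Union>k. F k))"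
  obtain k x' m where x': "x' \<in> cyl x n" "n \<le> m" "inv_rel (\<lambda>a b. (\<theta> a, \<theta> b) \<in> F k) x' m"
  proof (rule inv_rel_localize[of "\<lambda>k a b. (\<theta> a, \<theta> b) \<in> F k" "\<lambda>k a b. (\<theta> a, \<theta> b) \<in> F k" n x x n])
    show "bp_rel (\<lambda>a b. (\<theta> a, \<theta> b) \<in> F k)" for k by (rule ergodicD(5)[OF F \<theta> \<theta>])
    then show "bp_rel (\<lambda>a b. (\<theta> a, \<theta> b) \<in> F k)" for k .
    show eq: "equivp (\<lambda>a b. (\<theta> a, \<theta> b) \<in> F k)" for k by (rule ergodicD(4)[OF F \<theta>])
    show "(\<theta> a, \<theta> b) \<in> F k" if "(\<theta> a, \<theta> c) \<in> F k" "(\<theta> b, \<theta> c) \<in> F k" for k a b c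
      using that equivp_symp[OF eq] equivp_transp[OF eq] by blast
    show "good (\<lambda>a b. \<exists>k. (\<theta> a, \<theta> b) \<in> F k) y x n" if "y \<in> I" "y \<subseteq> {n..}" for y
      using inv(1) that unfolding inv_rel_def by simp
  qed (auto intro: that)
  have "generically_const (\<lambda>a b. (\<theta> a, \<theta> b) \<in> F k) x' m"
    by (rule ergodicD(3)[OF F \<theta> x'(3)])
  then have "generically_const (\<lambda>a b. (\<theta> a, \<theta> b) \<in> (\<Union>k. F k)) x' m"
    unfolding generically_const_def by (auto elim!: eventually_mono)
  then show "generically_const (\<lambda>a b. (\<theta> a, \<theta> b) \<in> (\<Union>k. F k)) x n"
    by (rule generically_const_spread[OF inv x'(1,2)])
qed

text \<open>Each entry becomes invariant on a subcylinder, since its class must reappear among the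
  countably many entries of a moved point. This yields countably many classes, recorded by
  \<open>V\<close>, and generically the set of classes of all entries is exactly the recorded one.
  The \<open>f k\<close> stand for the coordinate projections.\<close>

lemma ergodic_power:
  fixes f :: "nat \<Rightarrow> 'y \<Rightarrow> 'z"
  assumes f: "\<And>k. f k \<in> measurable M N" and F: "ergodic N F"
  shows "ergodic M {(x, y). x \<in> space M \<and> y \<in> space M \<and>
    (\<forall>k. \<exists>l. (f k x, f l y) \<in> F) \<and> (\<forall>l. \<exists>k. (f k x, f l y) \<in> F)}" (is "ergodic M ?F")
proof (rule ergodicI)
  have fsp: "f k x \<in> space N" if "x \<in> space M" for k x using measurable_space[OF f that] .
  have F': "refl_on (space N) F" "sym F" "trans F"
    using ergodicD(1)[OF F] by (auto simp: equiv_def)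
  show "equiv (space M) ?F"
  proof (rule equivI)
    show "refl_on (space M) ?F"
      using F'(1) fsp by (auto simp: refl_on_def)
    show "sym ?F"
      using F'(2) unfolding sym_def by blast
    show "trans ?F"
    proof (rule transI, clarsimp, intro conjI allI)
      fix x y z k
      assume "\<forall>k. \<exists>l. (f k x, f l y) \<in> F" "\<forall>k. \<exists>l. (f k y, f l z) \<in> F"
      then show "\<exists>l. (f k x, f l z) \<in> F" using F'(3) by (meson transD)
    next
      fix x y z l
      assume "\<forall>l. \<exists>k. (f k x, f l y) \<in> F" "\<forall>l. \<exists>k. (f k y, f l z) \<in> F"
      then show "\<exists>k. (f k x, f l z) \<in> F" using F'(3) by (meson transD)
    qed
  qed auto
  have G: "{z \<in> space (M \<Otimes>\<^sub>M M). (f k (fst z), f l (snd z)) \<in> F} \<in> sets (M \<Otimes>\<^sub>M M)" for k l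
  proof -
    have "(\<lambda>z. (f k (fst z), f l (snd z))) \<in> measurable (M \<Otimes>\<^sub>M M) (N \<Otimes>\<^sub>M N)"
      using f by measurable
    from measurable_sets[OF this ergodicD(2)[OF F]] show ?thesis
      by (simp add: vimage_def Int_def conj_commute)
  qed
  have "{z \<in> space (M \<Otimes>\<^sub>M M). (\<forall>k. \<exists>l. (f k (fst z), f l (snd z)) \<in> F) \<and>
      (\<forall>l. \<exists>k. (f k (fst z), f l (snd z)) \<in> F)} \<in> sets (M \<Otimes>\<^sub>M M)"
    by (intro sets.sets_Collect_conj sets.sets_Collect_countable_All sets.sets_Collect_countable_Ex G)
  also have "{z \<in> space (M \<Otimes>\<^sub>M M). (\<forall>k. \<exists>l. (f k (fst z), f l (snd z)) \<in> F) \<and>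
      (\<forall>l. \<exists>k. (f k (fst z), f l (snd z)) \<in> F)} = ?F"
    by (auto simp: space_pair_measure)
  finally show "?F \<in> sets (M \<Otimes>\<^sub>M M)" .
next
  fix \<theta> x n
  assume \<theta>: "\<theta> \<in> measurable bp_algebra M" and inv: "inv_rel (\<lambda>a b. (\<theta> a, \<theta> b) \<in> ?F) x n"
    "bp_rel (\<lambda>a b. (\<theta> a, \<theta> b) \<in> ?F)" "equivp (\<lambda>a b. (\<theta> a, \<theta> b) \<in> ?F)"
  define \<theta>' where "\<theta>' k a = f k (\<theta> a)" for k a
  have sp: "\<theta> a \<in> space M" for a using measurable_space[OF \<theta>] by simp
  have \<theta>': "\<theta>' k \<in> measurable bp_algebra N" for k
    unfolding \<theta>'_def using measurable_compose[OF \<theta> f] .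
  have eq: "equivp (\<lambda>a b. (\<theta>' k a, \<theta>' k b) \<in> F)" for k
    by (rule ergodicD(4)[OF F \<theta>'])
  have F': "sym F" "trans F" using ergodicD(1)[OF F] by (auto simp: equiv_def)
  \<comment> \<open>A code \<open>z\<close> consists of a finite prefix, giving a cylinder inside
    \<open>cyl x n\<close>, and the number of an entry; \<open>c\<close> is a constant for that
    entry there. Codes are countable, so one centre and one constant are fixed for each.\<close>
  define W where "W z p c \<longleftrightarrow> p \<in> cyl x n \<and> n \<le> length (fst z) \<and> fst z = map p [0..<length (fst z)] \<and>
    eventually (\<lambda>a. (\<theta>' (snd z) a, \<theta>' (snd z) c) \<in> F) (generic (cyl p (length (fst z))))" for z p c
  define V where "V = {z. \<exists>p c. W z p c}"
  have "\<forall>z\<in>V. \<exists>p c. W z p c" by (simp add: V_def)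
  then obtain p c where W: "\<And>z. z \<in> V \<Longrightarrow> W z (p z) (c z)" by metis
  note V = W[unfolded W_def]
  have fwd: "eventually (\<lambda>a. \<forall>k\<in>UNIV. \<exists>z\<in>V. (\<theta>' k a, \<theta>' (snd z) (c z)) \<in> F) (generic (cyl x n))"
  proof (rule generic_all_countable, rule cyl_cover)
    fix k q m assume q: "q \<in> cyl x n" "n \<le> m"
    obtain l q' m' where q': "q' \<in> cyl q m" "m \<le> m'" "inv_rel (\<lambda>a b. (\<theta>' k a, \<theta>' k b) \<in> F) q' m'"
    \<comment> \<open>Two points whose \<open>k\<close>-th entries match the same
      \<open>l\<close>-th entry of a third have equivalent \<open>k\<close>-th entries, whatever
      \<open>l\<close> is.\<close>
    proof (rule inv_rel_localize[of "\<lambda>l a b. (\<theta>' k a, \<theta>' l b) \<in> F" "\<lambda>l a b. (\<theta>' k a, \<theta>' k b) \<in> F" n x q m])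
      show "bp_rel (\<lambda>a b. (\<theta>' k a, \<theta>' l b) \<in> F)" for k l
        by (rule ergodicD(5)[OF F \<theta>' \<theta>'])
      then show "bp_rel (\<lambda>a b. (\<theta>' k a, \<theta>' k b) \<in> F)" .
      show "(\<theta>' k a, \<theta>' k b) \<in> F" if "(\<theta>' k a, \<theta>' l c) \<in> F" "(\<theta>' k b, \<theta>' l c) \<in> F" for l a b c
        using that F' by (meson symD transD)
      show "good (\<lambda>a b. \<exists>l. (\<theta>' k a, \<theta>' l b) \<in> F) y x n" if y: "y \<in> I" "y \<subseteq> {n..}" for y
      proof -
        have "good (\<lambda>a b. (\<theta> a, \<theta> b) \<in> ?F) y x n" using inv(1) y unfolding inv_rel_def by blast
        then show ?thesis unfolding good_def by (rule eventually_mono) (auto simp: \<theta>'_def)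
      qed
    qed (use q eq in \<open>auto intro: that\<close>)
    obtain d where d: "eventually (\<lambda>a. (\<theta>' k a, \<theta>' k d) \<in> F) (generic (cyl q' m'))"
      using ergodicD(3)[OF F \<theta>' q'(3)] unfolding generically_const_def by blast
    define z where "z = (map q' [0..<m'], k)"
    have "q' \<in> cyl x n" using q q' cyl_mono by blast
    then have "W z q' d"
      using d q(2) q'(2) unfolding W_def z_def by simp
    then have z: "z \<in> V" by (auto simp: V_def)
    \<comment> \<open>The centre and constant fixed for \<open>z\<close> may differ from
      \<open>q'\<close> and \<open>d\<close>, but the centres share the prefix and hence the
      cylinder.\<close>
    have cylz: "cyl (p z) m' = cyl q' m'"
      using V[OF z] by (intro cyl_eq) (simp add: z_def cyl_def)
    have ev: "eventually (\<lambda>a. (\<theta>' k a, \<theta>' k (c z)) \<in> F) (generic (cyl q' m'))"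
      using V[OF z] cylz by (simp add: z_def)
    have "eventually (\<lambda>a. \<exists>z\<in>V. (\<theta>' k a, \<theta>' (snd z) (c z)) \<in> F) (generic (cyl q' m'))"
      using ev by (rule eventually_mono) (intro bexI[OF _ z], simp add: z_def)
    then show "\<exists>q' m'. q' \<in> cyl q m \<and> m \<le> m' \<and>
      eventually (\<lambda>a. \<exists>z\<in>V. (\<theta>' k a, \<theta>' (snd z) (c z)) \<in> F) (generic (cyl q' m'))"
      using q' by blast
  qed
  have bwd: "eventually (\<lambda>a. \<forall>z\<in>V. \<exists>l. (\<theta>' l a, \<theta>' (snd z) (c z)) \<in> F) (generic (cyl x n))"
  proof (rule generic_all_countable)
    fix z assume "z \<in> V"
    note z = V[OF this]
    \<comment> \<open>Inside its own cylinder the recorded class is that of entry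
      \<open>snd z\<close>. Invariance relates a generic point elsewhere to one in that cylinder,
      and the power relation then supplies an entry \<open>l\<close>.\<close>
    have "eventually (\<lambda>a. \<exists>b. (\<theta> a, \<theta> b) \<in> ?F \<and> (\<theta>' (snd z) b, \<theta>' (snd z) (c z)) \<in> F) (generic (cyl x n))"
      by (rule inv_rel_spread[OF inv, of "p z" "length (fst z)"]) (use z in auto)
    then show "eventually (\<lambda>a. \<exists>l. (\<theta>' l a, \<theta>' (snd z) (c z)) \<in> F) (generic (cyl x n))"
    proof eventually_elim
      case (elim a)
      then obtain b where b: "(\<theta> a, \<theta> b) \<in> ?F" "(\<theta>' (snd z) b, \<theta>' (snd z) (c z)) \<in> F" by blast
      then obtain l where "(\<theta>' l a, \<theta>' (snd z) b) \<in> F" by (auto simp: \<theta>'_def)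
      then show ?case using b(2) F'(2) by (meson transD)
    qed
  qed
  from fwd bwd have ev: "eventually (\<lambda>a. (\<forall>k. \<exists>z\<in>V. (\<theta>' k a, \<theta>' (snd z) (c z)) \<in> F) \<and>
     (\<forall>z\<in>V. \<exists>l. (\<theta>' l a, \<theta>' (snd z) (c z)) \<in> F)) (generic (cyl x n))"
    by eventually_elim simp
  obtain d where d: "\<forall>k. \<exists>z\<in>V. (\<theta>' k d, \<theta>' (snd z) (c z)) \<in> F"
     "\<forall>z\<in>V. \<exists>l. (\<theta>' l d, \<theta>' (snd z) (c z)) \<in> F"
    using generic_cyl_ex[OF ev] by blast
  from ev have "eventually (\<lambda>a. (\<theta> a, \<theta> d) \<in> ?F) (generic (cyl x n))"
  proof eventually_elim
    case (elim a)
    have "\<exists>l. (\<theta>' k a, \<theta>' l d) \<in> F" for k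
      using elim d(2) F' by (meson symD transD)
    moreover have "\<exists>k. (\<theta>' k a, \<theta>' l d) \<in> F" for l
      using elim d(1) F' by (meson symD transD)
    ultimately show ?case using sp by (simp add: \<theta>'_def)
  qed
  then show "generically_const (\<lambda>a b. (\<theta> a, \<theta> b) \<in> ?F) x n"
    unfolding generically_const_def by blast
qed

end

section \<open>Class 4\<close>

lemma space_borel_of [simp]: "space (borel_of X) = topspace X"
  by (simp add: borel_of_def space_measure_of_conv)

lemma openin_borel_of: "openin X U \<Longrightarrow> U \<in> sets (borel_of X)"
  unfolding borel_of_def using openin_subset
  by (subst sets_measure_of) (auto intro: sigma_sets.Basic)

lemma measurable_borel_ofI:
  assumes "\<And>a. a \<in> space M \<Longrightarrow> f a \<in> topspace X"
    and "\<And>U. openin X U \<Longrightarrow> f -` U \<inter> space M \<in> sets M"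
  shows "f \<in> measurable M (borel_of X)"
  unfolding borel_of_def
proof (rule measurable_measure_of)
  show "{U. openin X U} \<subseteq> Pow (topspace X)" using openin_subset[of X] by blast
qed (use assms in auto)

lemma continuous_map_measurable:
  assumes "continuous_map X Y f"
  shows "f \<in> measurable (borel_of X) (borel_of Y)"
proof (rule measurable_borel_ofI)
  show "f a \<in> topspace Y" if "a \<in> space (borel_of X)" for a
    using assms that by (auto simp: continuous_map_def)
  fix U assume "openin Y U"
  then have "openin X {x \<in> topspace X. f x \<in> U}"
    using assms by (simp add: openin_continuous_map_preimage)
  moreover have "{x \<in> topspace X. f x \<in> U} = f -` U \<inter> space (borel_of X)" by auto
  ultimately show "f -` U \<inter> space (borel_of X) \<in> sets (borel_of X)"
    using openin_borel_of by metis
qed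

text \<open>Balls of radius \<open>1 / real (Suc m)\<close> about a countable dense set separate
  points. They present equality as a countable intersection of two-class relations.\<close>

lemma polish_separating_open:
  assumes "polish_space X"
  obtains B :: "nat \<times> nat \<Rightarrow> 'a set" where "\<And>i. openin X (B i)"
    "\<And>x y. x \<in> topspace X \<Longrightarrow> y \<in> topspace X \<Longrightarrow> (\<forall>i. x \<in> B i \<longleftrightarrow> y \<in> B i) \<Longrightarrow> x = y"
proof -
  obtain M d where M: "Metric_space M d" and X: "X = Metric_space.mtopology M d"
    using assms unfolding polish_space_def completely_metrizable_space_def by blast
  interpret Metric_space M d by fact
  obtain C where C: "countable C" "C \<subseteq> M" "mtopology closure_of C = M"
    using assms X unfolding polish_space_def separable_space_def by auto
  define B where "B = (\<lambda>(n, m). mball (from_nat_into C n) (1 / real (Suc m)))"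
  have "openin X (B i)" for i by (simp add: B_def X case_prod_beta)
  moreover have "x = y"
    if x: "x \<in> topspace X" and y: "y \<in> topspace X" and eq: "\<forall>i. x \<in> B i \<longleftrightarrow> y \<in> B i" for x y
  proof (rule ccontr)
    assume "x \<noteq> y"
    have xy: "x \<in> M" "y \<in> M" using x y by (auto simp: X)
    then have "d x y > 0" using \<open>x \<noteq> y\<close> by simp
    then obtain m where m: "1 / real (Suc m) < d x y / 2"
      using nat_approx_posE[of "d x y / 2"] by auto
    have "x \<in> mtopology closure_of C" using C xy by simp
    then obtain c where c: "c \<in> C" "d x c < 1 / real (Suc m)"
      unfolding metric_closure_of in_mball mem_Collect_eq
      by (metis of_nat_0_less_iff zero_less_Suc zero_less_divide_1_iff)
    have cM: "c \<in> M" using c C by blast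
    obtain n where n: "from_nat_into C n = c"
      using c C from_nat_into_surj by metis
    have "x \<in> B (n, m)" using c cM xy by (simp add: B_def n commute)
    then have "y \<in> B (n, m)" using eq by blast
    then have "d c y < 1 / real (Suc m)" by (simp add: B_def n)
    moreover have "d x y \<le> d x c + d c y" using triangle xy cM by blast
    ultimately show False using c m by linarith
  qed
  ultimately show ?thesis using that by blast
qed

section \<open>Generic ergodicity of the relations in Class 4\<close>

context tall_P_ideal
begin

lemma ergodic_total: "ergodic M (space M \<times> space M)"
proof -
  have "{(x, y). x \<in> space M \<and> y \<in> space M \<and> (x \<in> {} \<longleftrightarrow> y \<in> {})} = space M \<times> space M"
    by auto
  then show ?thesis using ergodic_two_classes[of "{}" M] by simp
qed

lemma ergodic_equality:
  assumes "polish_space X"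
  shows "ergodic (borel_of X) (Id_on (topspace X))"
proof -
  obtain B :: "nat \<times> nat \<Rightarrow> 'a set" where B: "\<And>i. openin X (B i)"
    "\<And>x y. x \<in> topspace X \<Longrightarrow> y \<in> topspace X \<Longrightarrow> (\<forall>i. x \<in> B i \<longleftrightarrow> y \<in> B i) \<Longrightarrow> x = y"
    by (rule polish_separating_open[OF assms]) blast
  have "Id_on (topspace X) = (\<Inter>i. {(x, y). x \<in> space (borel_of X) \<and> y \<in> space (borel_of X) \<and>
      (x \<in> B i \<longleftrightarrow> y \<in> B i)})"
  proof (intro equalityI subrelI)
    fix x y assume *: "(x, y) \<in> (\<Inter>i. {(x, y). x \<in> space (borel_of X) \<and> y \<in> space (borel_of X) \<and>
      (x \<in> B i \<longleftrightarrow> y \<in> B i)})"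
    then have "x = y" by (intro B(2)) auto
    then show "(x, y) \<in> Id_on (topspace X)" using * by auto
  qed auto
  moreover have "ergodic (borel_of X) \<dots>"
    by (intro ergodic_INT ergodic_two_classes openin_borel_of B(1))
  ultimately show ?thesis by simp
qed

lemma ergodic_continuous_vimage:
  assumes "continuous_map X Y f" "ergodic (borel_of Y) F"
  shows "ergodic (borel_of X) {(x, y). x \<in> topspace X \<and> y \<in> topspace X \<and> (f x, f y) \<in> F}"
  using ergodic_vimage[OF continuous_map_measurable[OF assms(1)] assms(2)] by simp

lemma ergodic_rel_homeomorphic:
  assumes "rel_homeomorphic X E Y F" "ergodic (borel_of Y) F"
  shows "ergodic (borel_of X) E"
proof -
  obtain h where h: "homeomorphic_map X Y h"
    "E = {(x, y). x \<in> topspace X \<and> y \<in> topspace X \<and> (h x, h y) \<in> F}"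
    using assms(1) unfolding rel_homeomorphic_def by blast
  show ?thesis
    unfolding h(2)
    by (rule ergodic_continuous_vimage[OF homeomorphic_imp_continuous_map[OF h(1)] assms(2)])
qed

text \<open>Two points of a sum are related iff they lie in the same summand and for every \<open>k\<close> their
  images under the map that collapses all summands but the \<open>k\<close>-th to a point are related.\<close>

lemma ergodic_disjoint_sum:
  fixes Y :: "nat \<Rightarrow> 'b topology"
  assumes F: "\<And>k. k \<in> I' \<Longrightarrow> ergodic (borel_of (Y k)) (F k)"
  shows "ergodic (borel_of (sum_topology Y I')) (disjoint_sum_rel I' F)"
proof -
  let ?S = "sum_topology Y I'"
  \<comment> \<open>The collapsed summands go to an arbitrary point of \<open>Y k\<close>, so
    \<open>f k\<close> maps into \<open>Y k\<close> only if that space is nonempty.\<close>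
  define f where "f k z = (if fst z = k then snd z else (SOME c. c \<in> topspace (Y k)))" for k and z :: "nat \<times> 'b"
  have some: "(SOME c. c \<in> topspace (Y k)) \<in> topspace (Y k)" if "topspace (Y k) \<noteq> {}" for k
    using that by (simp add: some_in_eq)
  have cont: "continuous_map ?S (Y k) (f k)" if k: "topspace (Y k) \<noteq> {}" for k
    unfolding continuous_map_def
  proof (intro conjI allI impI)
    show "f k \<in> topspace ?S \<rightarrow> topspace (Y k)" using some[OF k] by (auto simp: f_def)
    fix U assume U: "openin (Y k) U"
    have "openin (Y l) {x. (l, x) \<in> {z \<in> topspace ?S. f k z \<in> U}}" if "l \<in> I'" for l
    proof (cases "l = k")
      case True
      then have "{x. (l, x) \<in> {z \<in> topspace ?S. f k z \<in> U}} = U"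
        using openin_subset[OF U] that by (auto simp: f_def)
      then show ?thesis using U True by simp
    next
      case False
      then have "{x. (l, x) \<in> {z \<in> topspace ?S. f k z \<in> U}} =
          (if (SOME c. c \<in> topspace (Y k)) \<in> U then topspace (Y l) else {})"
        using that by (auto simp: f_def)
      then show ?thesis by simp
    qed
    then show "openin ?S {z \<in> topspace ?S. f k z \<in> U}"
      unfolding openin_sum_topology by auto
  qed
  \<comment> \<open>\<open>Inl k\<close> compares membership in summand \<open>k\<close>,
    \<open>Inr k\<close> compares images under \<open>f k\<close>; the total relation fills in where
    \<open>k\<close> is no index or \<open>Y k\<close> is empty.\<close>
  define G where "G i = (case i of
      Inl k \<Rightarrow> {(x, y). x \<in> topspace ?S \<and> y \<in> topspace ?S \<and> (x \<in> {z \<in> topspace ?S. fst z = k} \<longleftrightarrow> y \<in> {z \<in> topspace ?S. fst z = k})}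
    | Inr k \<Rightarrow> if k \<in> I' \<and> topspace (Y k) \<noteq> {}
        then {(x, y). x \<in> topspace ?S \<and> y \<in> topspace ?S \<and> (f k x, f k y) \<in> F k}
        else topspace ?S \<times> topspace ?S)" for i :: "nat + nat"
  have erg: "ergodic (borel_of ?S) (G i)" for i
  proof (cases i)
    case (Inl k)
    have "openin (Y l) {x. (l, x) \<in> {z \<in> topspace ?S. fst z = k}}" if "l \<in> I'" for l
    proof -
      have "{x. (l, x) \<in> {z \<in> topspace ?S. fst z = k}} = (if l = k then topspace (Y l) else {})"
        using that by auto
      then show ?thesis by simp
    qed
    then have "openin ?S {z \<in> topspace ?S. fst z = k}"
      unfolding openin_sum_topology by auto
    from ergodic_two_classes[OF openin_borel_of[OF this]] show ?thesis
      by (simp add: G_def Inl)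
  next
    case (Inr k)
    show ?thesis
      using ergodic_continuous_vimage[OF cont F, of k] ergodic_total[of "borel_of ?S"]
      by (simp add: G_def Inr)
  qed
  have "disjoint_sum_rel I' F = (\<Inter>i. G i)"
  proof (intro equalityI subrelI)
    fix x y assume xy: "(x, y) \<in> disjoint_sum_rel I' F"
    then obtain k a b where k: "x = (k, a)" "y = (k, b)" "k \<in> I'" "(a, b) \<in> F k"
      by (auto simp: disjoint_sum_rel_def)
    have equivF: "equiv (topspace (Y l)) (F l)" if "l \<in> I'" for l
      using ergodicD(1)[OF F[OF that]] by simp
    then have ab: "a \<in> topspace (Y k)" "b \<in> topspace (Y k)"
      using k by (auto simp: equiv_def)
    have "(f l x, f l y) \<in> F l" if "l \<in> I'" "topspace (Y l) \<noteq> {}" for l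
    proof (cases "l = k")
      case False
      then show ?thesis
        using equivF[OF that(1)] some[OF that(2)] k by (simp add: f_def equiv_def refl_on_def)
    qed (use k in \<open>simp add: f_def\<close>)
    then show "(x, y) \<in> (\<Inter>i. G i)"
      using k ab by (auto simp: G_def split: sum.split)
  next
    fix x y assume "(x, y) \<in> (\<Inter>i. G i)"
    then have xy: "(x, y) \<in> G (Inl (fst x))" "(x, y) \<in> G (Inr (fst x))" by auto
    then have S: "x \<in> topspace ?S" "y \<in> topspace ?S" "fst y = fst x" by (auto simp: G_def)
    then have "fst x \<in> I'" "topspace (Y (fst x)) \<noteq> {}" by auto
    then have "(snd x, snd y) \<in> F (fst x)" using xy(2) S(3) by (auto simp: G_def f_def)
    then show "(x, y) \<in> disjoint_sum_rel I' F"
      using S(3) \<open>fst x \<in> I'\<close> by (auto simp: disjoint_sum_rel_def case_prod_beta)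
  qed
  then show ?thesis using ergodic_INT[OF erg] by simp
qed

text \<open>\<open>K\<close> is separate from \<open>J\<close> to cover both all coordinates, for
  products, and the tails \<open>{m..}\<close>, for Fubini products.\<close>

lemma ergodic_coordinates:
  fixes Y :: "nat \<Rightarrow> 'b topology"
  assumes F: "\<And>k. k \<in> K \<Longrightarrow> ergodic (borel_of (Y k)) (F k)" and K: "K \<subseteq> J"
  shows "ergodic (borel_of (product_topology Y J))
    {(x, y). x \<in> topspace (product_topology Y J) \<and> y \<in> topspace (product_topology Y J) \<and>
      (\<forall>k\<in>K. (x k, y k) \<in> F k)}"
proof -
  let ?P = "product_topology Y J"
  define G where "G k = (if k \<in> K
      then {(x, y). x \<in> topspace ?P \<and> y \<in> topspace ?P \<and> (x k, y k) \<in> F k}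
      else topspace ?P \<times> topspace ?P)" for k
  have "ergodic (borel_of ?P) (G k)" for k
  proof (cases "k \<in> K")
    case True
    then have "continuous_map ?P (Y k) (\<lambda>x. x k)"
      using K by (intro continuous_map_product_projection) auto
    from ergodic_continuous_vimage[OF this F] show ?thesis using True by (simp add: G_def)
  next
    case False
    then show ?thesis using ergodic_total[of "borel_of ?P"] by (simp add: G_def)
  qed
  then have "ergodic (borel_of ?P) (\<Inter>k. G k)" by (rule ergodic_INT)
  moreover have "(\<Inter>k. G k) = {(x, y). x \<in> topspace ?P \<and> y \<in> topspace ?P \<and> (\<forall>k\<in>K. (x k, y k) \<in> F k)}"
  proof (intro equalityI subrelI)
    fix x y assume *: "(x, y) \<in> (\<Inter>k. G k)"
    have "x \<in> topspace ?P \<and> y \<in> topspace ?P \<and> (k \<in> K \<longrightarrow> (x k, y k) \<in> F k)" for k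
    proof -
      have "(x, y) \<in> G k" using * by blast
      then show ?thesis unfolding G_def by (cases "k \<in> K") simp_all
    qed
    then show "(x, y) \<in> {(x, y). x \<in> topspace ?P \<and> y \<in> topspace ?P \<and> (\<forall>k\<in>K. (x k, y k) \<in> F k)}"
      by blast
  qed (auto simp: G_def)
  ultimately show ?thesis by simp
qed

text \<open>A finite exceptional set means agreement on some tail \<open>{m..}\<close>, so the
  relation is a countable union of relations covered by \<open>ergodic_coordinates\<close>.\<close>

lemma ergodic_fubini:
  fixes Y :: "nat \<Rightarrow> 'b topology"
  assumes F: "\<And>k. ergodic (borel_of (Y k)) (F k)"
  shows "ergodic (borel_of (product_topology Y UNIV)) (fubini_rel Y F)"
proof -
  let ?P = "product_topology Y UNIV"
  define G where "G m = {(x, y). x \<in> topspace ?P \<and> y \<in> topspace ?P \<and> (\<forall>k\<in>{m..}. (x k, y k) \<in> F k)}" for m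
  have "finite A \<longleftrightarrow> (\<exists>m. \<forall>k\<in>{m..}. k \<notin> A)" for A :: "nat set"
    unfolding finite_nat_set_iff_bounded by (metis atLeast_iff not_less)
  then have G: "fubini_rel Y F = (\<Union>m. G m)"
    unfolding fubini_rel_def G_def by auto
  have refl: "(a, a) \<in> F k" if "a \<in> topspace (Y k)" for a k
    using ergodicD(1)[OF F[of k]] that by (auto simp: equiv_def refl_on_def)
  have sym: "(b, a) \<in> F k" if "(a, b) \<in> F k" for a b k
    using ergodicD(1)[OF F[of k]] that by (auto simp: equiv_def dest: symD)
  have trans: "(a, c) \<in> F k" if "(a, b) \<in> F k" "(b, c) \<in> F k" for a b c k
    using ergodicD(1)[OF F[of k]] that by (auto simp: equiv_def dest: transD)
  have "equiv (space (borel_of ?P)) (fubini_rel Y F)"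
  proof (rule equivI)
    show "refl_on (space (borel_of ?P)) (fubini_rel Y F)"
      by (auto simp: refl_on_def fubini_rel_def refl PiE_iff)
    show "sym (fubini_rel Y F)"
    proof (rule symI)
      fix x y assume xy: "(x, y) \<in> fubini_rel Y F"
      have "{k. (y k, x k) \<notin> F k} \<subseteq> {k. (x k, y k) \<notin> F k}" using sym by blast
      then show "(y, x) \<in> fubini_rel Y F" using xy by (auto simp: fubini_rel_def intro: finite_subset)
    qed
    show "trans (fubini_rel Y F)"
    proof (rule transI)
      fix x y z assume xyz: "(x, y) \<in> fubini_rel Y F" "(y, z) \<in> fubini_rel Y F"
      have "{k. (x k, z k) \<notin> F k} \<subseteq> {k. (x k, y k) \<notin> F k} \<union> {k. (y k, z k) \<notin> F k}" using trans by blast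
      then show "(x, z) \<in> fubini_rel Y F"
        using xyz by (auto simp: fubini_rel_def intro: finite_subset)
    qed
  qed (auto simp: fubini_rel_def)
  moreover have "ergodic (borel_of ?P) (G m)" for m
    unfolding G_def by (rule ergodic_coordinates) (use F in auto)
  ultimately show ?thesis unfolding G using ergodic_UN by blast
qed

lemma ergodic_countable_power:
  assumes F: "ergodic (borel_of Y) F"
  shows "ergodic (borel_of (product_topology (\<lambda>_. Y) UNIV)) (countable_power_rel Y F)"
proof -
  have "(\<lambda>x. x k) \<in> measurable (borel_of (product_topology (\<lambda>_. Y) (UNIV :: nat set))) (borel_of Y)" for k
    by (rule continuous_map_measurable) (rule continuous_map_product_projection, simp)
  from ergodic_power[OF this F] show ?thesis by (simp add: countable_power_rel_def)
qed

lemma ergodic_class4_code: "class4_code X E \<Longrightarrow> ergodic (borel_of X) E"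
proof (induction rule: class4_code.induct)
  case (equality X)
  then show ?case by (rule ergodic_equality)
next
  case (union X E)
  then show ?case by (intro ergodic_UN) auto
next
  case (intersection X E)
  then show ?case by (intro ergodic_INT)
next
  case (disjoint_sum I Y F X E)
  then show ?case using ergodic_rel_homeomorphic ergodic_disjoint_sum by blast
next
  case (product I Y F X E)
  have "ergodic (borel_of (product_topology Y I)) (product_rel I Y F)"
    unfolding product_rel_def by (rule ergodic_coordinates) (use product in auto)
  then show ?case using product ergodic_rel_homeomorphic by blast
next
  case (fubini Y F X E)
  then show ?case using ergodic_rel_homeomorphic ergodic_fubini by blast
next
  case (power Y F X E)
  then show ?case using ergodic_rel_homeomorphic ergodic_countable_power by blast
qed

lemma ergodic_class4:
  assumes "class4 X E"
  shows "ergodic (borel_of X) E"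
proof -
  obtain X' E' where *: "class4_code X' E'" "rel_homeomorphic X E X' E'"
    using assms unfolding class4_def by (elim exE conjE)
  show ?thesis by (rule ergodic_rel_homeomorphic[OF *(2) ergodic_class4_code[OF *(1)]])
qed

text \<open>A reduction is invariant at every point, hence generically constant on the whole space.
  Complementation preserves genericity, so some set would be equivalent to its complement, from
  which it differs by \<open>UNIV\<close>.\<close>

theorem not_reducible_to_ergodic:
  fixes \<theta> :: "(nat \<Rightarrow> bool) \<Rightarrow> 'y"
  assumes "ergodic M F" "UNIV \<notin> I" "\<theta> \<in> measurable bp_algebra M"
    and red: "\<And>x y. (\<theta> x, \<theta> y) \<in> F \<longleftrightarrow> {i. x i \<noteq> y i} \<in> I"
  shows False
proof -
  have "(\<theta> (base p), \<theta> (act y p)) \<in> F" if "y \<in> I" for y p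
    unfolding red by (rule subset_mem[OF that]) (auto simp: base_apply act_apply)
  then have "inv_rel (\<lambda>a b. (\<theta> a, \<theta> b) \<in> F) x 0" for x
    by (simp add: inv_rel_def good_def)
  from ergodicD(3)[OF assms(1,3) this] obtain c
    where ev: "eventually (\<lambda>x. (\<theta> x, \<theta> c) \<in> F) (generic UNIV)"
    unfolding generically_const_def by auto
  then have "eventually (\<lambda>x. (\<theta> (flip x UNIV), \<theta> c) \<in> F) (generic UNIV)"
    by (rule generic_flip) simp
  with ev have ev': "eventually (\<lambda>x. (\<theta> x, \<theta> (flip x UNIV)) \<in> F) (generic UNIV)"
  proof eventually_elim
    case (elim x)
    note eq = ergodicD(4)[OF assms(1,3)]
    show ?case using elim equivp_symp[OF eq] equivp_transp[OF eq] by blast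
  qed
  obtain x where "(\<theta> x, \<theta> (flip x UNIV)) \<in> F"
    using generic_cyl_ex[of "\<lambda>x. (\<theta> x, \<theta> (flip x UNIV)) \<in> F" undefined 0] ev' by auto
  then have "{i. x i \<noteq> flip x UNIV i} \<in> I" by (simp add: red)
  then show False using assms(2) by (simp add: flip_apply)
qed

end

section \<open>Analytic P-ideals\<close>

text \<open>The second components carry the witness for membership in an analytic set.\<close>

definition proj_set :: "(nat \<Rightarrow> bool \<times> nat) \<Rightarrow> nat set" where
  "proj_set p = {i. fst (p i)}"

definition cyl_closed :: "(nat \<Rightarrow> 'a) set \<Rightarrow> bool" where
  "cyl_closed C \<longleftrightarrow> (\<forall>p. (\<forall>n. cyl p n \<inter> C \<noteq> {}) \<longrightarrow> p \<in> C)"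

text \<open>These are the analytic sets: projections of closed subsets of Cantor space times Baire
  space.\<close>

definition suslin :: "nat set set \<Rightarrow> bool" where
  "suslin A \<longleftrightarrow> (\<exists>C. cyl_closed C \<and> A = proj_set ` C)"

lemma suslin_UN:
  assumes "\<And>k :: nat. suslin (A k)"
  shows "suslin (\<Union>k. A k)"
proof -
  obtain C where C: "\<And>k. cyl_closed (C k)" "\<And>k. A k = proj_set ` C k"
    using assms unfolding suslin_def by metis
  \<comment> \<open>Witness coordinate 0 carries the index \<open>k\<close>; the witness for
    \<open>A k\<close> is shifted by one.\<close>
  define S where "S p i = (fst (p i), snd (p (Suc i)))" for p :: "nat \<Rightarrow> bool \<times> nat" and i
  define D where "D = {p. S p \<in> C (snd (p 0))}"
  have "cyl_closed D"
    unfolding cyl_closed_def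
  proof (intro allI impI)
    fix p assume p: "\<forall>n. cyl p n \<inter> D \<noteq> {}"
    have "cyl (S p) n \<inter> C (snd (p 0)) \<noteq> {}" for n
    proof -
      obtain q where q: "q \<in> cyl p (Suc n)" "q \<in> D" using p by blast
      then have "S q \<in> cyl (S p) n" "q 0 = p 0" by (auto simp: cyl_def S_def)
      then show ?thesis using q(2) by (auto simp: D_def)
    qed
    then show "p \<in> D" using C(1) unfolding cyl_closed_def D_def by blast
  qed
  moreover have "(\<Union>k. A k) = proj_set ` D"
  proof (intro equalityI subsetI)
    fix x assume "x \<in> (\<Union>k. A k)"
    then obtain k q where q: "q \<in> C k" "x = proj_set q" using C(2) by blast
    define p where "p i = (fst (q i), case i of 0 \<Rightarrow> k | Suc j \<Rightarrow> snd (q j))" for i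
    have "S p = q" by (auto simp: S_def p_def)
    then have "p \<in> D" using q(1) by (simp add: D_def p_def)
    moreover have "x = proj_set p" using q(2) by (simp add: proj_set_def p_def)
    ultimately show "x \<in> proj_set ` D" by blast
  next
    fix x assume "x \<in> proj_set ` D"
    then obtain p where p: "S p \<in> C (snd (p 0))" "x = proj_set p" by (auto simp: D_def)
    have "proj_set p = proj_set (S p)" by (simp add: proj_set_def S_def)
    then show "x \<in> (\<Union>k. A k)" using p C(2) by blast
  qed
  ultimately show ?thesis unfolding suslin_def by blast
qed

lemma suslin_INT:
  assumes "\<And>k :: nat. suslin (A k)"
  shows "suslin (\<Inter>k. A k)"
proof -
  obtain C where C: "\<And>k. cyl_closed (C k)" "\<And>k. A k = proj_set ` C k"
    using assms unfolding suslin_def by metis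
  \<comment> \<open>The pairing function splits one witness into a witness for each
    \<open>k\<close>.\<close>
  define S where "S k p i = (fst (p i), snd (p (prod_encode (k, i))))"
    for k and p :: "nat \<Rightarrow> bool \<times> nat" and i
  define D where "D = {p. \<forall>k. S k p \<in> C k}"
  have proj: "proj_set (S k p) = proj_set p" for k p by (simp add: proj_set_def S_def)
  have "cyl_closed D"
    unfolding cyl_closed_def
  proof (intro allI impI)
    fix p assume p: "\<forall>n. cyl p n \<inter> D \<noteq> {}"
    have "cyl (S k p) n \<inter> C k \<noteq> {}" for k n
    proof -
      \<comment> \<open>Agreement below \<open>N\<close> settles the first \<open>n\<close>
        coordinates of \<open>S k p\<close>, whose witnesses sit at the positions
        \<open>prod_encode (k, i)\<close>.\<close>
      define N where "N = n + (\<Sum>i<n. Suc (prod_encode (k, i)))"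
      obtain q where q: "q \<in> cyl p N" "q \<in> D" using p by blast
      have "prod_encode (k, i) < N" if "i < n" for i
        using member_le_sum[of i "{..<n}" "\<lambda>i. Suc (prod_encode (k, i))"] that by (simp add: N_def)
      then have "S k q \<in> cyl (S k p) n" using q(1) by (auto simp: cyl_def S_def N_def)
      then show ?thesis using q(2) by (auto simp: D_def)
    qed
    then show "p \<in> D" using C(1) unfolding cyl_closed_def D_def by blast
  qed
  moreover have "(\<Inter>k. A k) = proj_set ` D"
  proof (intro equalityI subsetI)
    fix x assume "x \<in> (\<Inter>k. A k)"
    then have "\<forall>k. \<exists>q\<in>C k. x = proj_set q" using C(2) by blast
    then obtain q where q: "\<And>k. q k \<in> C k" "\<And>k. x = proj_set (q k)" by metis
    define p where "p i = (i \<in> x, snd (q (fst (prod_decode i)) (snd (prod_decode i))))" for i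
    have "S k p = q k" for k
    proof
      fix i
      have "fst (q k i) = (i \<in> x)" using q(2)[of k] by (simp add: proj_set_def)
      then show "S k p i = q k i" by (simp add: S_def p_def prod_eq_iff)
    qed
    then have "p \<in> D" using q(1) by (simp add: D_def)
    moreover have "x = proj_set p" by (simp add: proj_set_def p_def)
    ultimately show "x \<in> proj_set ` D" by blast
  next
    fix x assume "x \<in> proj_set ` D"
    then obtain p where p: "\<And>k. S k p \<in> C k" "x = proj_set p" by (auto simp: D_def)
    have "x \<in> A k" for k unfolding C(2) using p(1)[of k] p(2) proj[of k p] by blast
    then show "x \<in> (\<Inter>k. A k)" by blast
  qed
  ultimately show ?thesis unfolding suslin_def by blast
qed

section \<open>Borel subsets of Cantor space are analytic\<close>

lemma topspace_cantor_space [simp]: "topspace cantor_space = UNIV"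
  by (simp add: cantor_space_def topspace_pullback_topology)

lemma openin_cantor_space:
  assumes "openin cantor_space U" "s \<in> U"
  obtains N where "\<And>t. (\<forall>i<N. i \<in> t \<longleftrightarrow> i \<in> s) \<Longrightarrow> t \<in> U"
proof -
  obtain V where V: "openin (product_topology (\<lambda>_. discrete_topology UNIV) UNIV) V"
    "U = (\<lambda>x n. n \<in> x) -` V"
    using assms(1) unfolding cantor_space_def openin_pullback_topology by auto
  have "(\<lambda>n. n \<in> s) \<in> V" using V(2) assms(2) by auto
  from product_topology_open_contains_basis[OF V(1) this]
  obtain X where X: "(\<lambda>n. n \<in> s) \<in> (\<Pi>\<^sub>E i\<in>UNIV. X i)" "finite {i. X i \<noteq> (UNIV :: bool set)}"
    "(\<Pi>\<^sub>E i\<in>UNIV. X i) \<subseteq> V"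
    unfolding topspace_discrete_topology by (elim exE conjE)
  obtain N where N: "\<And>i. X i \<noteq> UNIV \<Longrightarrow> i < N"
    using X(2) unfolding finite_nat_set_iff_bounded by auto
  have "t \<in> U" if "\<forall>i<N. i \<in> t \<longleftrightarrow> i \<in> s" for t
  proof -
    have "(i \<in> t) \<in> X i" for i
      using N[of i] that X(1) by (cases "X i = UNIV") (auto simp: PiE_iff)
    then have "(\<lambda>n. n \<in> t) \<in> (\<Pi>\<^sub>E i\<in>UNIV. X i)" by auto
    then show ?thesis using X(3) V(2) by auto
  qed
  then show ?thesis using that by blast
qed

lemma suslin_open:
  assumes "openin cantor_space U"
  shows "suslin U" "suslin (- U)"
proof -
  \<comment> \<open>The witness at coordinate 0 is the length of an initial segment that already
    forces membership in \<open>U\<close>.\<close>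
  define C where "C = {p. \<forall>t. (\<forall>i<snd (p 0). i \<in> t \<longleftrightarrow> fst (p i)) \<longrightarrow> t \<in> U}"
  have "cyl_closed C"
    unfolding cyl_closed_def
  proof (intro allI impI)
    fix p assume "\<forall>n. cyl p n \<inter> C \<noteq> {}"
    \<comment> \<open>\<open>Suc\<close> ensures that coordinate 0, and with it the witness, is
      shared even when the length is 0.\<close>
    then obtain q where "q \<in> cyl p (Suc (snd (p 0)))" "q \<in> C" by blast
    then show "p \<in> C" by (auto simp: C_def cyl_def)
  qed
  moreover have "U = proj_set ` C"
  proof (intro equalityI subsetI)
    fix x assume "x \<in> U"
    obtain N where N: "\<And>t. (\<forall>i<N. i \<in> t \<longleftrightarrow> i \<in> x) \<Longrightarrow> t \<in> U"
      by (rule openin_cantor_space[OF assms \<open>x \<in> U\<close>]) blast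
    have "(\<lambda>i. (i \<in> x, N)) \<in> C" using N by (simp add: C_def)
    then show "x \<in> proj_set ` C"
      by (intro image_eqI[of _ _ "\<lambda>i. (i \<in> x, N)"]) (simp add: proj_set_def)
  next
    fix x assume "x \<in> proj_set ` C"
    then show "x \<in> U" by (auto simp: C_def proj_set_def)
  qed
  ultimately show "suslin U" unfolding suslin_def by blast
  define D where "D = {p. proj_set p \<notin> U}"
  have "cyl_closed D"
    unfolding cyl_closed_def
  proof (intro allI impI)
    fix p assume p: "\<forall>n. cyl p n \<inter> D \<noteq> {}"
    show "p \<in> D"
    proof (rule ccontr)
      assume "p \<notin> D"
      then have "proj_set p \<in> U" by (simp add: D_def)
      then obtain N where N: "\<And>t. (\<forall>i<N. i \<in> t \<longleftrightarrow> i \<in> proj_set p) \<Longrightarrow> t \<in> U"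
        by (rule openin_cantor_space[OF assms]) blast
      obtain q where q: "q \<in> cyl p N" "q \<in> D" using p by blast
      have "proj_set q \<in> U" using N[of "proj_set q"] q(1) by (simp add: cyl_def proj_set_def)
      then show False using q(2) by (simp add: D_def)
    qed
  qed
  moreover have "- U = proj_set ` D"
  proof (intro equalityI subsetI)
    fix x assume "x \<in> - U"
    then have "(\<lambda>i. (i \<in> x, 0)) \<in> D" by (simp add: D_def proj_set_def)
    then show "x \<in> proj_set ` D"
      by (intro image_eqI[of _ _ "\<lambda>i. (i \<in> x, 0)"]) (simp add: proj_set_def)
  qed (auto simp: D_def)
  ultimately show "suslin (- U)" unfolding suslin_def by blast
qed

text \<open>Analytic sets are not closed under complements, so the induction carries a set together
  with its complement.\<close>

lemma suslin_borel:
  assumes "Z \<in> sets (borel_of cantor_space)"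
  shows "suslin Z"
proof -
  have "Z \<in> sigma_sets UNIV {U. openin cantor_space U}"
    using assms by (simp add: borel_of_def)
  then have "suslin Z \<and> suslin (- Z)"
  proof (induction rule: sigma_sets.induct)
    case (Basic U)
    then show ?case using suslin_open by auto
  next
    case Empty
    have "openin cantor_space {}" by simp
    then show ?case by (intro conjI suslin_open)
  next
    case (Compl U)
    then show ?case by (simp add: Compl_eq_Diff_UNIV[symmetric])
  next
    case (Union A)
    then have "suslin (\<Union>i. A i)" "suslin (\<Inter>i. - A i)"
      by (auto intro: suslin_UN suslin_INT)
    then show ?case by simp
  qed
  then show ?thesis ..
qed

text \<open>Discard from the closed set coding \<open>Z\<close> every basic open piece whose projection is not cofinal
  in \<open>Z\<close> modulo finite. For each surviving piece \<open>L\<close> let \<open>W L\<close> be the set of numbers that belong to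
  no set coded in \<open>L\<close>; cofinality makes \<open>z \<inter> W L\<close> finite for \<open>z \<in> Z\<close>. If \<open>x\<close> is almost disjoint from
  all \<open>W L\<close>, then any infinite subset of \<open>x\<close> contains an infinite member of \<open>Z\<close>, built by
  shrinking the piece once for each of its elements.\<close>

theorem analytic_P_ideal_dichotomy:
  assumes P: "P_ideal Z" and "suslin Z"
  shows "(\<exists>W :: nat \<Rightarrow> nat set. Z = {x. \<forall>n. finite (x \<inter> W n)}) \<or>
    (\<exists>x. x \<notin> Z \<and> (\<forall>w\<subseteq>x. infinite w \<longrightarrow> (\<exists>z\<subseteq>w. infinite z \<and> z \<in> Z)))"
proof -
  obtain C where C: "cyl_closed C" "Z = proj_set ` C"
    using assms(2) unfolding suslin_def by blast
  have un: "x \<union> y \<in> Z" if "x \<in> Z" "y \<in> Z" for x y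
    using P that unfolding P_ideal_def set_ideal_def by blast
  have sub: "y \<in> Z" if "x \<in> Z" "y \<subseteq> x" for x y
    using P that unfolding P_ideal_def set_ideal_def by blast
  define node where "node L = {q \<in> C. map q [0..<length L] = L}" for L
  define cofinal where "cofinal A \<longleftrightarrow> (\<forall>z\<in>Z. \<exists>q\<in>A. finite (z - proj_set q))" for A
  define C' where "C' = {q \<in> C. \<forall>n. cofinal (node (map q [0..<n]))}"
  obtain z0 where "z0 \<in> Z" using P unfolding P_ideal_def set_ideal_def by auto
  have "\<exists>z\<in>Z. \<not> cofinal (node L) \<longrightarrow> (\<forall>q\<in>node L. infinite (z - proj_set q))" for L
    using \<open>z0 \<in> Z\<close> by (cases "cofinal (node L)") (auto simp: cofinal_def)
  then obtain bad where bad: "\<And>L. bad L \<in> Z"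
    "\<And>L q. \<not> cofinal (node L) \<Longrightarrow> q \<in> node L \<Longrightarrow> infinite (bad L - proj_set q)" by metis
  have "range (\<lambda>n. bad (from_nat n)) \<subseteq> Z" using bad(1) by blast
  \<comment> \<open>One member of \<open>Z\<close> almost contains a counterexample to cofinality
    for every piece that is not cofinal.\<close>
  then obtain b where b: "b \<in> Z" "\<And>n :: nat. finite (bad (from_nat n) - b)"
    using P unfolding P_ideal_def by meson
  have b': "finite (bad L - b)" for L using b(2)[of "to_nat L"] by simp
  have cof: "\<exists>q\<in>C' \<inter> node L. finite (z - proj_set q)" if L: "cofinal (node L)" and z: "z \<in> Z" for L z
  proof -
    \<comment> \<open>Adding \<open>b\<close> to \<open>z\<close> forces every piece through
      \<open>q\<close> to be cofinal, so that \<open>q\<close> survives into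
      \<open>C'\<close>.\<close>
    obtain q where q: "q \<in> node L" "finite (z \<union> b - proj_set q)"
      using L un[OF z b(1)] unfolding cofinal_def by blast
    have "cofinal (node (map q [0..<n]))" for n
    proof (rule ccontr)
      assume "\<not> ?thesis"
      then have "infinite (bad (map q [0..<n]) - proj_set q)"
        using bad(2) q(1) by (auto simp: node_def)
      moreover have "finite ((bad (map q [0..<n]) - b) \<union> (z \<union> b - proj_set q))"
        using b' q(2) by blast
      moreover have "bad (map q [0..<n]) - proj_set q \<subseteq> (bad (map q [0..<n]) - b) \<union> (z \<union> b - proj_set q)"
        by blast
      ultimately show False using finite_subset by blast
    qed
    then have "q \<in> C'" using q(1) by (simp add: C'_def node_def)
    moreover have "finite (z - proj_set q)" using q(2) by (rule rev_finite_subset) auto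
    ultimately show ?thesis using q(1) by blast
  qed
  have root: "node [] = C" by (simp add: node_def)
  have cofC: "cofinal (node [])" unfolding root cofinal_def C(2) by (metis Diff_cancel finite.emptyI imageE)
  \<comment> \<open>The value \<open>{}\<close> makes the pieces that are not cofinal impose no
    condition.\<close>
  define W where "W L = (if cofinal (node L) then {j. \<forall>q\<in>C' \<inter> node L. j \<notin> proj_set q} else {})" for L
  have W: "finite (z \<inter> W L)" if z: "z \<in> Z" for z L
  proof (cases "cofinal (node L)")
    case True
    then obtain q where q: "q \<in> C' \<inter> node L" "finite (z - proj_set q)" using cof[OF _ z] by blast
    have "z \<inter> W L \<subseteq> z - proj_set q" using q(1) by (auto simp: W_def True)
    then show ?thesis using q(2) finite_subset by blast
  qed (simp add: W_def)
  show ?thesis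
  proof (cases "Z = {x. \<forall>n. finite (x \<inter> W (from_nat n))}")
    case True
    then show ?thesis by (intro disjI1 exI[of _ "\<lambda>n. W (from_nat n)"])
  next
    case False
    then obtain x where x: "x \<notin> Z" "\<And>n :: nat. finite (x \<inter> W (from_nat n))" using W by blast
    have x': "finite (x \<inter> W L)" for L using x(2)[of "to_nat L"] by simp
    have "\<exists>z\<subseteq>w. infinite z \<and> z \<in> Z" if w: "w \<subseteq> x" "infinite w" for w
    proof -
      have "{} \<in> Z" using b(1) sub by blast
      then obtain q0 where q0: "q0 \<in> C'" using cof[OF cofC] by blast
      have step: "\<exists>q' m'. q' \<in> C' \<and> q' \<in> cyl q m \<and> m < m' \<and>
          (\<exists>j\<in>w. m \<le> j \<and> j < m' \<and> j \<in> proj_set q')" if q: "q \<in> C'" for q m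
      proof -
        define L where "L = map q [0..<m]"
        have L: "cofinal (node L)" using q by (simp add: C'_def L_def)
        \<comment> \<open>Almost every element of \<open>w\<close> avoids \<open>W L\<close> and so
          belongs to a set coded by a surviving point of the current piece; removing
          \<open>{..<m}\<close> makes successive choices increase.\<close>
        have "infinite (w - (x \<inter> W L) - {..<m})"
          using w(2) x' by (simp add: Diff_infinite_finite)
        then obtain j where "j \<in> w - (x \<inter> W L) - {..<m}"
          using infinite_imp_nonempty by (metis ex_in_conv)
        then have j: "j \<in> w" "j \<notin> W L" "m \<le> j" using w(1) by auto
        obtain q' where q': "q' \<in> C' \<inter> node L" "j \<in> proj_set q'"
          using j(2) L by (auto simp: W_def)
        then have "q' \<in> cyl q m" by (auto simp: node_def L_def cyl_def)
        then show ?thesis using q' j by (intro exI[of _ q'] exI[of _ "Suc j"]) auto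
      qed
      obtain q m r where r: "\<And>i :: nat. q i \<in> C'"
        "\<And>i. \<exists>j\<in>w. m i \<le> j \<and> j < m (Suc i) \<and> j \<in> proj_set (q (Suc i))"
        "\<And>i. m i < m (Suc i)" "\<And>i. r \<in> cyl (q i) (m i)"
        by (rule cyl_recursion[of "\<lambda>q. q \<in> C'" q0
              "\<lambda>i m q' m'. \<exists>j\<in>w. m \<le> j \<and> j < m' \<and> j \<in> proj_set q'" 0])
          (use q0 step in blast)+
      have ge: "i \<le> m i" for i
        using r(3) by (simp add: strict_mono_imp_increasing strict_mono_Suc_iff)
      have "r \<in> C"
      proof -
        have "q n \<in> cyl r n" for n
          using r(4)[of n] ge[of n] by (auto simp: cyl_def)
        moreover have "q n \<in> C" for n using r(1) by (auto simp: C'_def)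
        ultimately show ?thesis using C(1) unfolding cyl_closed_def by blast
      qed
      then have "proj_set r \<in> Z" using C(2) by blast
      then have "w \<inter> proj_set r \<in> Z" by (rule sub) auto
      moreover have "infinite (w \<inter> proj_set r)"
        unfolding infinite_nat_iff_unbounded_le
      proof
        fix i
        obtain j where j: "j \<in> w" "m i \<le> j" "j < m (Suc i)" "j \<in> proj_set (q (Suc i))"
          using r(2) by blast
        then have "j \<in> proj_set r" using r(4)[of "Suc i"] by (auto simp: proj_set_def cyl_def)
        then show "\<exists>j\<ge>i. j \<in> w \<inter> proj_set r" using j ge[of i] by (intro exI[of _ j]) auto
      qed
      ultimately show ?thesis by blast
    qed
    then show ?thesis using x(1) by blast
  qed
qed

section \<open>Ideals orthogonal to countably many sets\<close>

lemma isomorphic_I3: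
  fixes U :: "nat \<Rightarrow> nat set"
  assumes part: "\<And>r. \<exists>!k. r \<in> U k" and inf: "\<And>k. infinite (U k)"
  shows "isomorphic_ideals {x. \<forall>k. finite (x \<inter> U k)} I3"
proof -
  define col where "col r = (THE k. r \<in> U k)" for r
  have col: "r \<in> U k \<longleftrightarrow> k = col r" for r k
    using part[of r] theI'[OF part[of r]] unfolding col_def by blast
  define h where "h k = to_nat_on (U k)" for k
  have h: "bij_betw (h k) (U k) UNIV" for k
    unfolding h_def by (rule to_nat_on_infinite) (use inf in auto)
  \<comment> \<open>Each class \<open>U k\<close> is enumerated onto the column over
    \<open>k\<close>.\<close>
  define f where "f r = (col r, h (col r) r)" for r
  have "inj f"
  proof (rule injI)
    fix r s assume "f r = f s"
    then have "col s = col r" "h (col r) r = h (col r) s" by (auto simp: f_def)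
    then show "r = s" using h[of "col r"] col by (metis bij_betw_def inj_onD)
  qed
  moreover have "surj f"
    unfolding surj_def
  proof
    fix z :: "nat \<times> nat"
    obtain r where "r \<in> U (fst z)" "h (fst z) r = snd z"
      using h[of "fst z"] by (metis UNIV_I bij_betw_def imageE)
    then show "\<exists>r. z = f r" using col by (intro exI[of _ r]) (auto simp: f_def prod_eq_iff)
  qed
  moreover have "x \<in> {x. \<forall>k. finite (x \<inter> U k)} \<longleftrightarrow> f ` x \<in> I3" for x
  proof -
    have "{j. (k, j) \<in> f ` x} = h k ` (x \<inter> U k)" for k
      using col by (auto simp: f_def image_iff)
    moreover have "finite (h k ` (x \<inter> U k)) \<longleftrightarrow> finite (x \<inter> U k)" for k
      using h[of k] by (intro finite_image_iff) (auto simp: bij_betw_def intro: inj_on_subset)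
    ultimately show ?thesis by (simp add: I3_def)
  qed
  ultimately show ?thesis unfolding isomorphic_ideals_def bij_def by blast
qed

text \<open>Make the \<open>W n\<close> disjoint and drop the finite pieces. If finitely many
  remain, they merge into one set \<open>S\<close>, and the sizes of \<open>S\<close> and its
  complement decide between the first three cases; infinitely many give \<open>I3\<close>.\<close>

lemma countably_orthogonal_cases:
  fixes W :: "nat \<Rightarrow> nat set"
  assumes Z: "Z = {x. \<forall>n. finite (x \<inter> W n)}"
  shows "Z = UNIV \<or> Z = Fin \<or> trivial_variation_of_Fin Z \<or> isomorphic_ideals Z I3"
proof -
  define V where "V = disjointed W"
  have "(\<forall>n. finite (x \<inter> W n)) \<longleftrightarrow> (\<forall>n. finite (x \<inter> V n))" for x
  proof
    assume "\<forall>n. finite (x \<inter> W n)"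
    then show "\<forall>n. finite (x \<inter> V n)"
      using disjointed_subset[of W] unfolding V_def by (meson Int_mono finite_subset order_refl)
  next
    assume fin: "\<forall>n. finite (x \<inter> V n)"
    show "\<forall>n. finite (x \<inter> W n)"
    proof
      fix n
      have "W n \<subseteq> (\<Union>i\<in>{0..<Suc n}. V i)"
        unfolding V_def finite_UN_disjointed_eq by auto
      then have "x \<inter> W n \<subseteq> (\<Union>i\<in>{0..<Suc n}. x \<inter> V i)" by blast
      moreover have "finite (\<Union>i\<in>{0..<Suc n}. x \<inter> V i)" using fin by blast
      ultimately show "finite (x \<inter> W n)" by (rule finite_subset)
    qed
  qed
  then have ZV: "Z = {x. \<forall>n. finite (x \<inter> V n)}" by (simp add: Z)
  have disj: "m = n" if "r \<in> V m" "r \<in> V n" for r m n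
    using disjoint_family_disjointed[of W] that unfolding V_def disjoint_family_on_def by blast
  define J where "J = {n. infinite (V n)}"
  have ZJ: "Z = {x. \<forall>n\<in>J. finite (x \<inter> V n)}"
    unfolding ZV J_def by auto
  show ?thesis
  proof (cases "finite J")
    case True
    define S where "S = (\<Union>n\<in>J. V n)"
    have "x \<inter> S = (\<Union>n\<in>J. x \<inter> V n)" for x by (auto simp: S_def)
    then have ZS: "Z = {x. finite (x \<inter> S)}" unfolding ZJ using True by (simp only: finite_UN)
    consider "finite S" | "infinite S" "infinite (- S)" | "finite (- S)" by blast
    then show ?thesis
    proof cases
      case 1
      then show ?thesis by (simp add: ZS)
    next
      case 2
      then show ?thesis unfolding trivial_variation_of_Fin_def ZS by blast
    next
      case 3
      have "finite x" if "finite (x \<inter> S)" for x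
        using finite_subset[of x "(x \<inter> S) \<union> - S"] that 3 by blast
      then have "Z = Fin" unfolding ZS Fin_def by blast
      then show ?thesis by blast
    qed
  next
    case False
    define e where "e = enumerate J"
    have e: "bij_betw e UNIV J" unfolding e_def by (rule bij_enumerate[OF False])
    define R where "R = - (\<Union>k. V (e k))"
    \<comment> \<open>The leftover \<open>R\<close> may be infinite; giving each \<open>U k\<close>
      at most one of its points yields a partition without changing which intersections are
      finite.\<close>
    define U where "U k = V (e k) \<union> (R \<inter> {k})" for k
    have eJ: "e k \<in> J" for k using e by (auto simp: bij_betw_def)
    have "\<exists>!k. r \<in> U k" for r
    proof (cases "r \<in> R")
      case True
      then show ?thesis by (auto simp: U_def R_def)
    next
      case False
      then obtain k where "r \<in> V (e k)" by (auto simp: R_def)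
      moreover have "l = k" if "r \<in> V (e l)" for l
        using disj[OF that \<open>r \<in> V (e k)\<close>] e by (auto simp: bij_betw_def inj_on_def)
      ultimately show ?thesis using False by (auto simp: U_def)
    qed
    moreover have "infinite (U k)" for k using eJ[of k] by (simp add: U_def J_def)
    ultimately have "isomorphic_ideals {x. \<forall>k. finite (x \<inter> U k)} I3" by (rule isomorphic_I3)
    moreover have "{x. \<forall>k. finite (x \<inter> U k)} = Z"
    proof -
      have "finite (x \<inter> U k) \<longleftrightarrow> finite (x \<inter> V (e k))" for x k
        by (simp add: U_def Int_Un_distrib)
      moreover have "J = range e" using e by (simp add: bij_betw_def)
      ultimately show ?thesis unfolding ZJ by simp
    qed
    ultimately show ?thesis by simp
  qed
qed

section \<open>Restriction to a set outside the ideal\<close>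

lemma measurable_image_cantor:
  assumes e: "inj e"
  shows "(\<lambda>x. e ` {i. x i}) \<in> measurable bp_algebra (borel_of cantor_space)"
proof (rule measurable_borel_ofI)
  show "e ` {i. x i} \<in> topspace cantor_space" for x
    by simp
  fix U assume U: "openin cantor_space U"
  have "baire_property ((\<lambda>x. e ` {i. x i}) -` U)"
  proof (rule baire_property_open)
    fix x assume "x \<in> (\<lambda>x. e ` {i. x i}) -` U"
    then obtain N where N: "\<And>t. (\<forall>i<N. i \<in> t \<longleftrightarrow> i \<in> e ` {i. x i}) \<Longrightarrow> t \<in> U"
      using openin_cantor_space[OF U, of "e ` {i. x i}"] by auto
    \<comment> \<open>By injectivity an initial segment of the image depends on finitely many
      coordinates of \<open>x\<close>, so the map is continuous.\<close>
    have "finite (e -` {..<N})" by (rule finite_vimageI[OF _ e]) simp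
    then obtain M where M: "\<And>j. e j < N \<Longrightarrow> j < M"
      unfolding finite_nat_set_iff_bounded by auto
    have "y \<in> (\<lambda>x. e ` {i. x i}) -` U" if "y \<in> cyl x M" for y
    proof -
      have "i \<in> e ` {i. y i} \<longleftrightarrow> i \<in> e ` {i. x i}" if "i < N" for i
        using M \<open>y \<in> cyl x M\<close> that by (force simp: cyl_def)
      then show ?thesis using N[of "e ` {i. y i}"] by simp
    qed
    then show "\<exists>n. cyl x n \<subseteq> (\<lambda>x. e ` {i. x i}) -` U" by blast
  qed
  then show "(\<lambda>x. e ` {i. x i}) -` U \<inter> space bp_algebra \<in> sets bp_algebra"
    by (simp add: sets_bp)
qed

lemma P_ideal_vimage:
  fixes e :: "nat \<Rightarrow> nat"
  assumes P: "P_ideal Z" and e: "inj e"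
  shows "P_ideal {a. e ` a \<in> Z}"
proof -
  have sub: "y \<in> Z" if "x \<in> Z" "y \<subseteq> x" for x y
    using P that unfolding P_ideal_def set_ideal_def by blast
  have un: "x \<union> y \<in> Z" if "x \<in> Z" "y \<in> Z" for x y
    using P that unfolding P_ideal_def set_ideal_def by blast
  obtain z0 where "z0 \<in> Z" using P unfolding P_ideal_def set_ideal_def by auto
  then have "e ` {} \<in> Z" using sub by auto
  then have "set_ideal {a. e ` a \<in> Z}"
    unfolding set_ideal_def image_Un using un sub[OF _ image_mono[of _ _ e]]
    by (intro conjI) (blast, simp_all add: image_Un)
  moreover have "\<exists>y\<in>{a. e ` a \<in> Z}. \<forall>n. finite (x n - y)"
    if x: "range x \<subseteq> {a. e ` a \<in> Z}" for x :: "nat \<Rightarrow> nat set"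
  proof -
    have "range (\<lambda>n. e ` x n) \<subseteq> Z" using x by auto
    then obtain z where z: "z \<in> Z" "\<And>n. finite (e ` x n - z)"
      using P unfolding P_ideal_def by meson
    have "finite (x n - e -` z)" for n
    proof -
      have "e ` (x n - e -` z) \<subseteq> e ` x n - z" by auto
      then have "finite (e ` (x n - e -` z))" using z(2) finite_subset by blast
      then show ?thesis by (rule finite_imageD) (rule inj_on_subset[OF e subset_UNIV])
    qed
    moreover have "e -` z \<in> {a. e ` a \<in> Z}" using sub[OF z(1), of "e ` (e -` z)"] by auto
    ultimately show ?thesis by blast
  qed
  ultimately show ?thesis unfolding P_ideal_def by blast
qed

theorem theorem2:
  fixes Z :: "nat set set" and Y :: "'a topology" and F :: "('a \<times> 'a) set"
  assumes "P_ideal Z"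
    and "Z \<in> sets (borel_of cantor_space)"
    and "\<forall>n. {n} \<in> Z"
    and "Z \<noteq> UNIV"
    and "Z \<noteq> Fin"
    and "\<not> trivial_variation_of_Fin Z"
    and "\<not> isomorphic_ideals Z I3"
    and "class4 Y F"
  shows "\<not> borel_reducible cantor_space (ideal_rel Z) Y F"
proof
  assume "borel_reducible cantor_space (ideal_rel Z) Y F"
  then obtain f where f: "f \<in> measurable (borel_of cantor_space) (borel_of Y)"
    "\<And>x y. (x, y) \<in> ideal_rel Z \<longleftrightarrow> (f x, f y) \<in> F"
    unfolding borel_reducible_def topspace_cantor_space by (elim bexE) blast
  have un: "x \<union> y \<in> Z" if "x \<in> Z" "y \<in> Z" for x y
    using assms(1) that unfolding P_ideal_def set_ideal_def by blast
  have sub: "y \<in> Z" if "x \<in> Z" "y \<subseteq> x" for x y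
    using assms(1) that unfolding P_ideal_def set_ideal_def by blast
  have fin: "a \<in> Z" if "finite a" for a
    using that
  proof (induction a)
    case empty
    then show ?case using assms(3) sub by blast
  next
    case (insert j a)
    then show ?case using un[of "{j}" a] assms(3) by simp
  qed
  \<comment> \<open>The orthogonal alternative of the dichotomy leads only to ideals excluded by the
    assumptions.\<close>
  obtain x0 where x0: "x0 \<notin> Z" "\<And>w. w \<subseteq> x0 \<Longrightarrow> infinite w \<Longrightarrow> \<exists>z\<subseteq>w. infinite z \<and> z \<in> Z"
    using analytic_P_ideal_dichotomy[OF assms(1) suslin_borel[OF assms(2)]]
      countably_orthogonal_cases[of Z] assms(4-7) by blast
  have inf: "infinite x0" using fin x0(1) by blast
  \<comment> \<open>Enumerating \<open>x0\<close> identifies the restriction of \<open>Z\<close> to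
    \<open>x0\<close> with an ideal on all of the naturals, which is proper because
    \<open>x0\<close> is not in \<open>Z\<close>.\<close>
  define e where "e = enumerate x0"
  have "bij_betw e UNIV x0" unfolding e_def by (rule bij_enumerate[OF inf])
  then have e: "inj e" "range e = x0" by (auto simp: bij_betw_def)
  define I where "I = {a. e ` a \<in> Z}"
  interpret tall_P_ideal I
  proof
    show "P_ideal I" unfolding I_def by (rule P_ideal_vimage[OF assms(1) e(1)])
    show "a \<in> I" if "finite a" for a using that fin by (simp add: I_def)
    show "\<exists>y\<subseteq>A. infinite y \<and> y \<in> I" if A: "infinite A" for A
    proof -
      have "infinite (e ` A)" using A e(1) by (meson finite_imageD inj_on_subset subset_UNIV)
      then obtain z where z: "z \<subseteq> e ` A" "infinite z" "z \<in> Z" using x0(2)[of "e ` A"] e(2) by blast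
      then obtain y where "y \<subseteq> A" "z = e ` y" by (metis subset_imageE)
      then show ?thesis using z by (intro exI[of _ y]) (auto simp: I_def)
    qed
  qed
  show False
  proof (rule not_reducible_to_ergodic[OF ergodic_class4[OF assms(8)]])
    show "UNIV \<notin> I" using x0(1) e(2) by (simp add: I_def)
    show "(\<lambda>x. f (e ` {i. x i})) \<in> measurable bp_algebra (borel_of Y)"
      using measurable_compose[OF measurable_image_cantor[OF e(1)] f(1)] .
    fix x y :: "nat \<Rightarrow> bool"
    have "sym_diff (e ` {i. x i}) (e ` {i. y i}) = e ` {i. x i \<noteq> y i}"
      using e(1) by (auto simp: inj_def)
    then show "(f (e ` {i. x i}), f (e ` {i. y i})) \<in> F \<longleftrightarrow> {i. x i \<noteq> y i} \<in> I"
      using f(2)[of "e ` {i. x i}" "e ` {i. y i}"] by (simp add: ideal_rel_def I_def)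
  qed
qed

end
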